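(* Let $(X,T)$ be a uniquely ergodic topological dynamical system with unique $T$-invariant Borel probability measure $\mu$, and let $d$ denote the metric on $X$. Let $(q_n)$ be an increasing sequence of positive integers satisfying $\gcd(q_n,q_{n+1})=1$ for all $n$, such that $$\max_{t<q_{n+1}^{4/5}}\ \sup_{x\in X} d(x,T^{tq_n}x)\longrightarrow 0\quad\text{as } n\to\infty,$$ where $t$ ranges over nonnegative integers. Then for every $f\in C(X)$, $$\lim_{N\to\infty}\frac1N\sum_{0\le i<N} f(T^{i^2}x)=\int_X f\,d\mu$$ uniformly in $x\in X$.
   Context: A topological dynamical system is a pair $(X,T)$ with $X$ a compact metric space and $T:X\to X$ a homeomorphism. It is uniquely ergodic if there is exactly one $T$-invariant Borel probability measure on $X$. $C(X)$ is the space of continuous functions on $X$. *)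

theory Defs
  imports "HOL-Probability.Probability"
begin

text \<open>The phase space is a whole type \<open>'a\<close>, and \<open>dist\<close> is the metric on it.\<close>

definition topological_dynamical_system :: "('a::metric_space \<Rightarrow> 'a) \<Rightarrow> bool" where
  "topological_dynamical_system T \<longleftrightarrow>
     compact (UNIV :: 'a set) \<and> (\<exists>S. homeomorphism UNIV UNIV T S)"

definition invariant_borel_prob :: "('a::topological_space \<Rightarrow> 'a) \<Rightarrow> 'a measure \<Rightarrow> bool" where
  "invariant_borel_prob T \<mu> \<longleftrightarrow>
     sets \<mu> = sets borel \<and> prob_space \<mu> \<and>
     (\<forall>A\<in>sets borel. emeasure \<mu> (T -` A) = emeasure \<mu> A)"

definition uniquely_ergodic :: "('a::topological_space \<Rightarrow> 'a) \<Rightarrow> bool" where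
  "uniquely_ergodic T \<longleftrightarrow> (\<exists>!\<mu>. invariant_borel_prob T \<mu>)"

end

theory Submission
  imports Defs "HOL-Number_Theory.Cong" "HOL-Library.Real_Mod" "HOL-Real_Asymp.Real_Asymp"
begin

text \<open>
  Let \<open>p = q\<^sub>n\<close>, \<open>k = q\<^sub>n\<^sub>+\<^sub>1\<close> and let \<open>N\<close> range over \<open>k\<^sup>4\<^sup>/\<^sup>5 \<le> N < R\<close>, where \<open>R\<close> is the \<open>4/5\<close>-th power of
  \<open>q\<^sub>n\<^sub>+\<^sub>2\<close>.  The average over \<open>i < N\<close> changes little if \<open>i\<close> is replaced by \<open>i + u + v\<close> and averaged over
  \<open>u, v < J\<close> with \<open>J\<close> about \<open>k\<^sup>3\<^sup>/\<^sup>4\<close>.  With \<open>y\<close> the image of \<open>x\<close> under the \<open>i\<^sup>2\<close>-th iterate,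
  rigidity along \<open>p\<close> permits adding \<open>s p\<close>, \<open>s < J\<close>, to the exponent \<open>m = 2 i (u + v) + (u + v)\<^sup>2\<close>,
  and rigidity along \<open>k\<close> permits reducing \<open>m + s p\<close> modulo \<open>k\<close>.
  As \<open>p\<close> and \<open>k\<close> are coprime, the residues of \<open>m + s p\<close> are equidistributed modulo \<open>k\<close> in mean square:
  at a frequency whose reduced denominator \<open>Q\<close> is small the linear sum over \<open>s\<close> is at most \<open>Q\<close>, and
  if \<open>Q\<close> is large the sum over \<open>u, v\<close>, being bilinear, is small by Cauchy-Schwarz and orthogonality.
  What remains is the average of \<open>f (T\<^sup>a y)\<close> over \<open>a < k\<close>, which converges uniformly by unique ergodicity.
\<close>

section \<open>Exponential sums\<close>

definition add_char :: "nat \<Rightarrow> nat \<Rightarrow> complex" where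
  "add_char q m = cis (2 * pi * real m / real q)"

lemma add_char_0 [simp]: "add_char q 0 = 1"
  by (simp add: add_char_def)

lemma norm_add_char [simp]: "norm (add_char q m) = 1"
  by (simp add: add_char_def)

lemma add_char_nonzero [simp]: "add_char q m \<noteq> 0"
  by (simp add: add_char_def)

lemma add_char_add: "add_char q (m + n) = add_char q m * add_char q n"
  by (simp add: add_char_def cis_mult ring_distribs add_divide_distrib)

lemma add_char_mult: "add_char q (k * m) = add_char q m ^ k"
  by (simp add: add_char_def Complex.DeMoivre mult_ac)

lemma add_char_cancel: "g > 0 \<Longrightarrow> add_char (g * q) (g * m) = add_char q m"
  by (simp add: add_char_def mult_ac)

lemma add_char_eq_1_iff:
  assumes "q > 0"
  shows "add_char q m = 1 \<longleftrightarrow> q dvd m"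
proof
  assume "add_char q m = 1"
  then obtain n where "2 * pi * real m / real q = of_int n * (2 * pi)"
    unfolding add_char_def cis_eq_1_iff by blast
  hence "real m = of_int n * real q"
    using assms by (simp add: field_simps)
  hence "of_int (int m) = (of_int (n * int q) :: real)" by simp
  hence "int m = n * int q" by (simp only: of_int_eq_iff)
  thus "q dvd m" by (metis dvd_triv_right int_dvd_int_iff)
next
  assume "q dvd m"
  then obtain k where "m = q * k" by blast
  hence "2 * pi * real m / real q = 2 * pi * real k" using assms by simp
  thus "add_char q m = 1" unfolding add_char_def by (simp only:) (rule cis_multiple_2pi, simp)
qed

lemma add_char_eq_iff:
  assumes "q > 0"
  shows "add_char q a = add_char q b \<longleftrightarrow> [a = b] (mod q)"
proof -
  have *: "add_char q a = add_char q b \<longleftrightarrow> [a = b] (mod q)" if "a \<le> b" for a b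
  proof -
    have "add_char q b = add_char q a * add_char q (b - a)"
      using that by (simp flip: add_char_add)
    hence "add_char q a = add_char q b \<longleftrightarrow> add_char q (b - a) = 1" by auto
    also have "\<dots> \<longleftrightarrow> [b = a] (mod q)"
      using that assms by (simp add: add_char_eq_1_iff cong_altdef_nat)
    finally show ?thesis by (simp add: cong_sym_eq)
  qed
  show ?thesis using *[of a b] *[of b a] by (metis cong_sym_eq nle_le)
qed

lemma cnj_add_char: "cnj (add_char q m) = inverse (add_char q m)"
  by (simp add: add_char_def cis_cnj)

text \<open>The summands are powers of the ratio \<open>z\<close> of the two characters, a
  \<open>q\<close>-th root of unity, so the geometric sum vanishes unless \<open>z = 1\<close>,
  which means that \<open>a\<close> and \<open>b\<close> are congruent.\<close>

lemma add_char_orthogonal: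
  assumes "q > 0"
  shows "(\<Sum>k<q. add_char q (k * a) * cnj (add_char q (k * b))) =
           (if [a = b] (mod q) then of_nat q else 0)"
proof -
  define z where "z = add_char q a / add_char q b"
  have "(\<Sum>k<q. add_char q (k * a) * cnj (add_char q (k * b))) = (\<Sum>k<q. z ^ k)"
    by (simp add: z_def cnj_add_char add_char_mult power_divide divide_inverse power_mult_distrib)
  also have "\<dots> = (if [a = b] (mod q) then of_nat q else 0)"
  proof (cases "z = 1")
    case True
    hence "[a = b] (mod q)" using assms by (simp add: z_def add_char_eq_iff)
    with True show ?thesis by simp
  next
    case False
    hence ncong: "\<not> [a = b] (mod q)" using assms by (simp add: z_def flip: add_char_eq_iff)
    have "add_char q a ^ q = 1" "add_char q b ^ q = 1"
      using assms by (simp_all add: add_char_eq_1_iff flip: add_char_mult)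
    hence "z ^ q = 1" by (simp add: z_def power_divide)
    with False ncong show ?thesis by (simp add: geometric_sum)
  qed
  finally show ?thesis .
qed

text \<open>Expanding the square and summing over the frequencies \<open>k\<close> first leaves, by
  orthogonality, only the pairs with congruent phases.\<close>

lemma sum_norm_exp_sum_squared:
  fixes b :: "'i \<Rightarrow> complex"
  assumes "q > 0" "finite X"
  shows "complex_of_real (\<Sum>k<q. (norm (\<Sum>x\<in>X. b x * add_char q (k * \<phi> x)))\<^sup>2) =
           of_nat q * (\<Sum>x\<in>X. \<Sum>y | y \<in> X \<and> [\<phi> x = \<phi> y] (mod q). b x * cnj (b y))"
proof -
  have "complex_of_real (\<Sum>k<q. (norm (\<Sum>x\<in>X. b x * add_char q (k * \<phi> x)))\<^sup>2) =
     (\<Sum>k<q. (\<Sum>x\<in>X. \<Sum>y\<in>X. b x * cnj (b y) * (add_char q (k * \<phi> x) * cnj (add_char q (k * \<phi> y)))))"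
    unfolding of_real_sum complex_norm_square by (simp add: sum_product mult_ac)
  also have "\<dots> = (\<Sum>x\<in>X. \<Sum>y\<in>X. \<Sum>k<q. b x * cnj (b y) * (add_char q (k * \<phi> x) * cnj (add_char q (k * \<phi> y))))"
    by (subst sum.swap, rule sum.cong[OF refl], subst sum.swap, rule refl)
  also have "\<dots> = (\<Sum>x\<in>X. \<Sum>y\<in>X. b x * cnj (b y) * (if [\<phi> x = \<phi> y] (mod q) then of_nat q else 0))"
    using assms by (simp add: add_char_orthogonal flip: sum_distrib_left)
  also have "\<dots> = of_nat q * (\<Sum>x\<in>X. \<Sum>y\<in>X. if [\<phi> x = \<phi> y] (mod q) then b x * cnj (b y) else 0)"
    unfolding sum_distrib_left by (intro sum.cong refl) auto
  also have "(\<Sum>x\<in>X. \<Sum>y\<in>X. if [\<phi> x = \<phi> y] (mod q) then b x * cnj (b y) else 0) =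
     (\<Sum>x\<in>X. \<Sum>y | y \<in> X \<and> [\<phi> x = \<phi> y] (mod q). b x * cnj (b y))"
    using assms(2) by (simp add: sum.inter_filter)
  finally show ?thesis .
qed

text \<open>Parseval's identity: phases distinct modulo \<open>q\<close> leave only the diagonal. It
  serves both for Fourier coefficients and for the linear sums over \<open>s\<close>.\<close>

lemma sum_norm_exp_sum_squared_inj:
  fixes b :: "'i \<Rightarrow> complex"
  assumes "q > 0" "finite X" "\<And>x y. x \<in> X \<Longrightarrow> y \<in> X \<Longrightarrow> [\<phi> x = \<phi> y] (mod q) \<Longrightarrow> x = y"
  shows "(\<Sum>k<q. (norm (\<Sum>x\<in>X. b x * add_char q (k * \<phi> x)))\<^sup>2) = real q * (\<Sum>x\<in>X. (norm (b x))\<^sup>2)"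
proof -
  have "(\<Sum>x\<in>X. \<Sum>y | y \<in> X \<and> [\<phi> x = \<phi> y] (mod q). b x * cnj (b y)) = (\<Sum>x\<in>X. b x * cnj (b x))"
  proof (rule sum.cong[OF refl])
    fix x assume "x \<in> X"
    hence "{y. y \<in> X \<and> [\<phi> x = \<phi> y] (mod q)} = {x}" using assms(3) by auto
    thus "(\<Sum>y | y \<in> X \<and> [\<phi> x = \<phi> y] (mod q). b x * cnj (b y)) = b x * cnj (b x)" by simp
  qed
  also have "\<dots> = complex_of_real (\<Sum>x\<in>X. (norm (b x))\<^sup>2)"
    unfolding of_real_sum complex_norm_square ..
  finally have "complex_of_real (\<Sum>k<q. (norm (\<Sum>x\<in>X. b x * add_char q (k * \<phi> x)))\<^sup>2) =
      complex_of_real (real q * (\<Sum>x\<in>X. (norm (b x))\<^sup>2))"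
    unfolding sum_norm_exp_sum_squared[OF assms(1,2)] by simp
  thus ?thesis by (simp only: of_real_eq_iff)
qed

text \<open>Each of the \<open>card X\<close> rows of surviving pairs has at most \<open>c\<close>
  entries, each of modulus at most 1.\<close>

lemma sum_norm_exp_sum_squared_le:
  fixes b :: "'i \<Rightarrow> complex"
  assumes "q > 0" "finite X" "\<And>x. x \<in> X \<Longrightarrow> norm (b x) \<le> 1"
    and "\<And>x. x \<in> X \<Longrightarrow> card {y \<in> X. [\<phi> x = \<phi> y] (mod q)} \<le> c"
  shows "(\<Sum>k<q. (norm (\<Sum>x\<in>X. b x * add_char q (k * \<phi> x)))\<^sup>2) \<le> real q * (real (card X) * real c)"
proof -
  have "(\<Sum>k<q. (norm (\<Sum>x\<in>X. b x * add_char q (k * \<phi> x)))\<^sup>2) =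
        norm (complex_of_real (\<Sum>k<q. (norm (\<Sum>x\<in>X. b x * add_char q (k * \<phi> x)))\<^sup>2))"
    unfolding norm_of_real by (simp add: sum_nonneg)
  also have "\<dots> = real q * norm (\<Sum>x\<in>X. \<Sum>y | y \<in> X \<and> [\<phi> x = \<phi> y] (mod q). b x * cnj (b y))"
    unfolding sum_norm_exp_sum_squared[OF assms(1,2)] by (simp add: norm_mult)
  also have "\<dots> \<le> real q * (\<Sum>x\<in>X. \<Sum>y | y \<in> X \<and> [\<phi> x = \<phi> y] (mod q). 1)"
    using assms(3) by (intro mult_left_mono sum_norm_le) (auto simp: norm_mult intro!: mult_le_one)
  also have "\<dots> = real q * (\<Sum>x\<in>X. real (card {y \<in> X. [\<phi> x = \<phi> y] (mod q)}))" by simp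
  also have "\<dots> \<le> real q * (\<Sum>x\<in>X. real c)"
    using assms(4) by (intro mult_left_mono sum_mono) auto
  finally show ?thesis by simp
qed

text \<open>Expand \<open>F\<close> in characters modulo \<open>q\<close>. Frequency 0 yields the
  mean of \<open>F\<close>; at the others, Cauchy-Schwarz separates the coefficients from the
  exponential sums, and Parseval bounds the square sum of the coefficients by \<open>B^2\<close>.
  Thus only a mean square of exponential sums has to be estimated.\<close>

lemma equidistribution_defect:
  fixes F :: "nat \<Rightarrow> complex"
  assumes q: "q > 0" and X: "finite X" and B: "\<And>a. a < q \<Longrightarrow> norm (F a) \<le> B"
  shows "norm ((\<Sum>x\<in>X. F (\<phi> x mod q)) - of_nat (card X) * ((\<Sum>a<q. F a) / of_nat q)) \<le>
           B * sqrt (\<Sum>k\<in>{1..<q}. (norm (\<Sum>x\<in>X. add_char q (k * \<phi> x)))\<^sup>2)"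
proof -
  have B0: "B \<ge> 0" using B[OF q] norm_ge_zero order_trans by blast
  define c where "c k = (\<Sum>a<q. F a * cnj (add_char q (k * a))) / of_nat q" for k
  define W where "W k = (\<Sum>x\<in>X. add_char q (k * \<phi> x))" for k
  have inv: "F (m mod q) = (\<Sum>k<q. c k * add_char q (k * m))" for m
  proof -
    have "(\<Sum>k<q. c k * add_char q (k * m)) =
          (\<Sum>k<q. \<Sum>a<q. F a * (add_char q (k * m) * cnj (add_char q (k * a)))) / of_nat q"
      unfolding c_def sum_divide_distrib sum_distrib_right by (simp add: mult_ac)
    also have "\<dots> = (\<Sum>a<q. F a * (\<Sum>k<q. add_char q (k * m) * cnj (add_char q (k * a)))) / of_nat q"
      by (subst sum.swap) (simp add: sum_distrib_left)
    also have "\<dots> = (\<Sum>a<q. if m mod q = a then F a * of_nat q else 0) / of_nat q"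
      unfolding add_char_orthogonal[OF q]
      by (intro arg_cong[where f="\<lambda>z. z / _"] sum.cong) (auto simp: cong_def)
    also have "\<dots> = F (m mod q)" using q by simp
    finally show ?thesis ..
  qed
  have "(\<Sum>x\<in>X. F (\<phi> x mod q)) = (\<Sum>k<q. c k * W k)"
    unfolding inv W_def sum_distrib_left by (rule sum.swap)
  also have "{..<q} = insert 0 {1..<q}" using q by auto
  also have "(\<Sum>k\<in>insert 0 {1..<q}. c k * W k) = c 0 * W 0 + (\<Sum>k\<in>{1..<q}. c k * W k)" by simp
  also have "c 0 * W 0 = of_nat (card X) * ((\<Sum>a<q. F a) / of_nat q)"
    by (simp add: c_def W_def)
  finally have "norm ((\<Sum>x\<in>X. F (\<phi> x mod q)) - of_nat (card X) * ((\<Sum>a<q. F a) / of_nat q)) =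
     norm (\<Sum>k\<in>{1..<q}. c k * W k)" by simp
  also have "\<dots> \<le> (\<Sum>k\<in>{1..<q}. norm (c k) * norm (W k))"
    by (rule order_trans[OF norm_sum]) (simp add: norm_mult)
  also have "\<dots> \<le> sqrt (\<Sum>k\<in>{1..<q}. (norm (c k))\<^sup>2) * sqrt (\<Sum>k\<in>{1..<q}. (norm (W k))\<^sup>2)"
    using L2_set_mult_ineq[of "\<lambda>k. norm (c k)" "\<lambda>k. norm (W k)" "{1..<q}"] by (simp add: L2_set_def)
  also have "\<dots> \<le> B * sqrt (\<Sum>k\<in>{1..<q}. (norm (W k))\<^sup>2)"
  proof (intro mult_right_mono real_le_lsqrt B0)
    \<comment> \<open>Conjugation brings the coefficient into the form of the Parseval identity
      above, where the characters stand unconjugated.\<close>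
    have nc: "norm (c k) = norm (\<Sum>a<q. cnj (F a) * add_char q (k * a)) / real q" for k
    proof -
      have "cnj (\<Sum>a<q. F a * cnj (add_char q (k * a))) = (\<Sum>a<q. cnj (F a) * add_char q (k * a))" by simp
      hence "norm (\<Sum>a<q. F a * cnj (add_char q (k * a))) = norm (\<Sum>a<q. cnj (F a) * add_char q (k * a))"
        by (metis complex_mod_cnj)
      thus ?thesis by (simp add: c_def norm_divide)
    qed
    have "(\<Sum>k\<in>{1..<q}. (norm (c k))\<^sup>2) \<le> (\<Sum>k<q. (norm (c k))\<^sup>2)"
      by (intro sum_mono2) auto
    also have "\<dots> = (\<Sum>k<q. (norm (\<Sum>a<q. cnj (F a) * add_char q (k * a)))\<^sup>2) / (real q)\<^sup>2"
      by (simp add: nc power_divide sum_divide_distrib)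
    also have "(\<Sum>k<q. (norm (\<Sum>a<q. cnj (F a) * add_char q (k * a)))\<^sup>2) = real q * (\<Sum>a<q. (norm (cnj (F a)))\<^sup>2)"
      using q by (intro sum_norm_exp_sum_squared_inj) (auto simp: cong_def)
    also have "\<dots> \<le> real q * (\<Sum>a<q. B\<^sup>2)"
      using B by (intro mult_left_mono sum_mono) (auto intro!: power_mono)
    finally show "(\<Sum>k\<in>{1..<q}. (norm (c k))\<^sup>2) \<le> B\<^sup>2"
      using q by (simp add: divide_right_mono power2_eq_square field_simps)
  qed (auto intro: sum_nonneg)
  finally show ?thesis by (simp add: W_def)
qed

section \<open>Bilinear and linear exponential sums\<close>

lemma card_residue_class_le:
  assumes "Q > 0"
  shows "card {m::nat. m < M \<and> m mod Q = r} \<le> M div Q + 1"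
proof -
  have "inj_on (\<lambda>m. m div Q) {m. m < M \<and> m mod Q = r}"
    by (rule inj_onI) (metis (mono_tags, lifting) div_mult_mod_eq mem_Collect_eq)
  moreover have "(\<lambda>m. m div Q) ` {m. m < M \<and> m mod Q = r} \<subseteq> {..M div Q}"
    by (auto intro: div_le_mono)
  ultimately have "card {m. m < M \<and> m mod Q = r} \<le> card {..M div Q}"
    by (intro card_inj_on_le) auto
  thus ?thesis by simp
qed

lemma sum_periodic:
  fixes h :: "nat \<Rightarrow> real"
  assumes "\<And>u. h (u + Q) = h u"
  shows "(\<Sum>u<n * Q. h u) = real n * (\<Sum>u<Q. h u)"
proof -
  have per: "h (i * Q + u) = h u" for i u
  proof (induction i)
    case (Suc i)
    have "h (Suc i * Q + u) = h ((i * Q + u) + Q)" by (simp add: algebra_simps)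
    with Suc assms show ?case by simp
  qed simp
  have "(\<Sum>u\<in>{i * Q..<i * Q + Q}. h u) = (\<Sum>u<Q. h u)" for i
    using sum.shift_bounds_nat_ivl[of h 0 "i * Q" Q] per
    by (simp add: add.commute atLeast0LessThan)
  thus ?thesis by (simp flip: sum.nat_group)
qed

text \<open>The frequency \<open>g * k\<close> modulo \<open>g * Q\<close> has reduced fraction
  \<open>k / Q\<close>, so \<open>Q\<close> is a period. Cauchy-Schwarz in \<open>u\<close> discards
  the weights \<open>a\<close>; orthogonality over full periods of \<open>u\<close> then reduces the
  estimate to counting congruent pairs of \<open>v\<close>.\<close>

lemma bilinear_exp_sum_bound:
  fixes a b :: "nat \<Rightarrow> complex"
  assumes "g > 0" "Q > 0" "coprime k Q"
    and a: "\<And>u. norm (a u) \<le> 1" and b: "\<And>v. norm (b v) \<le> 1"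
  shows "(norm (\<Sum>u<J. \<Sum>v<J. a u * b v * add_char (g * Q) (g * k * (2 * u * v))))\<^sup>2
           \<le> real J ^ 2 * (2 * real J ^ 2 / real Q + 3 * real J + real Q)"
proof -
  define h where "h u = (\<Sum>v<J. b v * add_char Q (u * (2 * k * v)))" for u
  have hper: "h (u + Q) = h u" for u
  proof -
    have "add_char Q (Q * n) = 1" for n
      using assms(2) by (simp add: add_char_eq_1_iff)
    thus ?thesis by (simp add: h_def add_char_add distrib_right)
  qed
  have eq: "add_char (g * Q) (g * k * (2 * u * v)) = add_char Q (u * (2 * k * v))" for u v
  proof -
    have "g * k * (2 * u * v) = g * (u * (2 * k * v))" by simp
    thus ?thesis using assms(1) by (simp only: add_char_cancel)
  qed
  have "norm (\<Sum>u<J. \<Sum>v<J. a u * b v * add_char (g * Q) (g * k * (2 * u * v)))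
      = norm (\<Sum>u<J. a u * h u)"
    unfolding eq h_def by (simp add: sum_distrib_left mult.assoc)
  also have "\<dots> \<le> (\<Sum>u<J. 1 * norm (h u))"
    using a by (intro sum_norm_le) (auto simp: norm_mult intro!: mult_left_le_one_le)
  finally have "(norm (\<Sum>u<J. \<Sum>v<J. a u * b v * add_char (g * Q) (g * k * (2 * u * v))))\<^sup>2
      \<le> (\<Sum>u<J. 1 * norm (h u))\<^sup>2" by (intro power_mono) auto
  also have "\<dots> \<le> (\<Sum>u<J. 1\<^sup>2) * (\<Sum>u<J. (norm (h u))\<^sup>2)"
    by (rule Cauchy_Schwarz_ineq_sum)
  \<comment> \<open>Positivity allows completing the range of \<open>u\<close> to whole periods.\<close>
  also have "(\<Sum>u<J. (norm (h u))\<^sup>2) \<le> (\<Sum>u<(J div Q + 1) * Q. (norm (h u))\<^sup>2)"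
  proof (rule sum_mono2)
    have "J < (J div Q + 1) * Q" 
      using assms(2) by (metis Suc_eq_plus1 dividend_less_div_times mult.commute mult_Suc add.commute)
    thus "{..<J} \<subseteq> {..<(J div Q + 1) * Q}" by auto
  qed auto
  also have "\<dots> = real (J div Q + 1) * (\<Sum>u<Q. (norm (h u))\<^sup>2)"
    by (rule sum_periodic) (simp add: hper)
  also have "(\<Sum>u<Q. (norm (h u))\<^sup>2) \<le> real Q * (real (card {..<J}) * real (2 * J div Q + 1))"
    unfolding h_def
  proof (rule sum_norm_exp_sum_squared_le)
    fix v assume "v \<in> {..<J}"
    \<comment> \<open>\<open>k\<close> can be cancelled, but 2 need not be invertible modulo
      \<open>Q\<close>. Therefore the even numbers \<open>2 * y\<close> below \<open>2 * J\<close>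
      are counted in a residue class, whence \<open>2 * J div Q + 1\<close>.\<close>
    have "card {y \<in> {..<J}. [2 * k * v = 2 * k * y] (mod Q)} \<le>
          card {m. m < 2 * J \<and> m mod Q = (2 * v) mod Q}"
    proof (rule card_inj_on_le)
      show "inj_on (\<lambda>y. 2 * y) {y \<in> {..<J}. [2 * k * v = 2 * k * y] (mod Q)}"
        by (auto intro: inj_onI)
      have "(2 * v) mod Q = (2 * y) mod Q" if "[2 * k * v = 2 * k * y] (mod Q)" for y
      proof -
        from that have "[k * (2 * v) = k * (2 * y)] (mod Q)" by (simp add: mult_ac)
        hence "[2 * v = 2 * y] (mod Q)"
          using assms(3) by (simp only: cong_mult_lcancel_nat)
        thus ?thesis by (simp add: cong_def)
      qed
      thus "(\<lambda>y. 2 * y) ` {y \<in> {..<J}. [2 * k * v = 2 * k * y] (mod Q)} \<subseteq>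
            {m. m < 2 * J \<and> m mod Q = (2 * v) mod Q}" by force
    qed auto
    also have "\<dots> \<le> 2 * J div Q + 1" by (rule card_residue_class_le) fact
    finally show "card {y \<in> {..<J}. [2 * k * v = 2 * k * y] (mod Q)} \<le> 2 * J div Q + 1" .
  qed (use assms b in auto)
  also have "(\<Sum>u<J. 1\<^sup>2 :: real) * (real (J div Q + 1) * (real Q * (real (card {..<J}) * real (2 * J div Q + 1))))
     \<le> real J * ((real J / real Q + 1) * (real Q * (real J * (2 * real J / real Q + 1))))"
  proof -
    have "real (J div Q) \<le> real J / real Q" "real (2 * J div Q) \<le> 2 * real J / real Q"
      using of_nat_div_le_of_nat[of J Q, where ?'a=real] of_nat_div_le_of_nat[of "2 * J" Q, where ?'a=real] by simp_all
    thus ?thesis by (simp, intro mult_mono) auto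
  qed
  also have "\<dots> = real J ^ 2 * (2 * real J ^ 2 / real Q + 3 * real J + real Q)"
    using assms(2) by (simp add: field_simps power2_eq_square)
  finally show ?thesis by (simp add: mult_left_mono)
qed

text \<open>A full period of powers of \<open>z\<close> sums to 0, so only \<open>S mod Q\<close>
  terms of modulus 1 survive.\<close>

lemma linear_exp_sum_bound:
  fixes z :: complex
  assumes "norm z = 1" "z ^ Q = 1" "z \<noteq> 1" "Q > 0"
  shows "norm (\<Sum>s<S. z ^ s) \<le> real Q"
proof -
  have "z ^ S = z ^ (Q * (S div Q) + S mod Q)" by simp
  also have "\<dots> = z ^ (S mod Q)" using assms(2) by (simp only: power_add power_mult) simp
  finally have "(\<Sum>s<S. z ^ s) = (\<Sum>s<S mod Q. z ^ s)"
    using assms(3) by (simp add: geometric_sum)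
  also have "norm \<dots> \<le> (\<Sum>s<S mod Q. 1)"
    using assms(1) by (intro sum_norm_le) (simp add: norm_power)
  also have "\<dots> \<le> real Q" using mod_less_divisor[OF assms(4), of S] by simp
  finally show ?thesis .
qed

text \<open>\<open>k\<close> is determined by the reduced numerator and denominator of
  \<open>k / q\<close>; as \<open>k < q\<close>, a denominator of at most \<open>D\<close> leaves at
  most \<open>D\<close> choices for each of them.\<close>

lemma card_small_denominator_le:
  "card {k \<in> {1..<q}. q div gcd k q \<le> D} \<le> D\<^sup>2" 
proof -
  let ?A = "{k \<in> {1..<q}. q div gcd k q \<le> D}"
  have "inj_on (\<lambda>k. (k div gcd k q, q div gcd k q)) ?A"
  proof (rule inj_onI)
    fix k l assume kl: "k \<in> ?A" "l \<in> ?A"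
      and eq: "(k div gcd k q, q div gcd k q) = (l div gcd l q, q div gcd l q)"
    have "gcd k q * (q div gcd k q) = gcd l q * (q div gcd k q)"
      using eq by (metis Pair_inject dvd_mult_div_cancel gcd_dvd2)
    moreover have "q div gcd k q \<noteq> 0" using kl by (auto simp: div_eq_0_iff not_less gcd_le2_nat)
    ultimately have "gcd k q = gcd l q" by (metis mult_right_cancel)
    with eq show "k = l" by (metis Pair_inject dvd_div_mult_self gcd_dvd1)
  qed
  moreover have "(\<lambda>k. (k div gcd k q, q div gcd k q)) ` ?A \<subseteq> {..<D} \<times> {1..D}"
  proof -
    have "k div gcd k q < q div gcd k q" "q div gcd k q \<ge> 1" if "k < q" for k
    proof -
      show "q div gcd k q \<ge> 1" using that by (simp add: Suc_le_eq div_greater_zero_iff gcd_le2_nat)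
      show "k div gcd k q < q div gcd k q"
        using that by (intro div_less_mono) auto
    qed
    thus ?thesis by force
  qed
  ultimately have "card ?A \<le> card ({..<D} \<times> {1..D})" by (intro card_inj_on_le) auto
  thus ?thesis by (simp add: power2_eq_square)
qed

text \<open>Expanding \<open>(u + v)^2\<close> factors each sum into a bilinear \<open>G k\<close>
  and a geometric \<open>H k\<close>. At most \<open>D^2\<close> frequencies have reduced
  denominator at most \<open>D\<close>; there \<open>H k\<close> is at most \<open>D\<close> and
  \<open>G k\<close> is bounded trivially. At the others \<open>G k\<close> is small, and the mean
  square of \<open>H k\<close> is known exactly by Parseval.\<close>

lemma quadratic_exp_sum_mean_square:
  fixes p q c J S D :: nat
  assumes q: "q > 0" and cop: "coprime p q" and S: "S \<le> q" and D: "D > 0"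
  shows "(\<Sum>k\<in>{1..<q}. (norm (\<Sum>(u, v, s)\<in>{..<J} \<times> {..<J} \<times> {..<S}.
            add_char q (k * (2 * c * (u + v) + (u + v)\<^sup>2 + s * p))))\<^sup>2)
         \<le> real D ^ 4 * real J ^ 4
            + real J ^ 2 * (2 * real J ^ 2 / real D + 3 * real J + real q) * (real q * real S)"
proof -
  define G where "G k = (\<Sum>u<J. \<Sum>v<J. add_char q (k * (2 * c * u + u\<^sup>2)) * add_char q (k * (2 * c * v + v\<^sup>2))
      * add_char q (k * (2 * u * v)))" for k
  define H where "H k = (\<Sum>s<S. 1 * add_char q (k * (s * p)))" for k
  define M where "M = real J ^ 2 * (2 * real J ^ 2 / real D + 3 * real J + real q)"
  have M0: "M \<ge> 0" by (simp add: M_def)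
  have W: "(\<Sum>(u, v, s)\<in>{..<J} \<times> {..<J} \<times> {..<S}.
            add_char q (k * (2 * c * (u + v) + (u + v)\<^sup>2 + s * p))) = G k * H k" for k
  proof -
    have "add_char q (k * (2 * c * (u + v) + (u + v)\<^sup>2 + s * p)) =
       add_char q (k * (2 * c * u + u\<^sup>2)) * add_char q (k * (2 * c * v + v\<^sup>2))
      * add_char q (k * (2 * u * v)) * add_char q (k * (s * p))" for u v s
      unfolding add_char_add[symmetric] by (simp add: algebra_simps power2_eq_square)
    thus ?thesis
      unfolding G_def H_def sum_distrib_right unfolding sum_distrib_left
      by (simp add: sum.cartesian_product[symmetric])
  qed
  \<comment> \<open>The phases \<open>s * p\<close> are distinct modulo \<open>q\<close> because
    \<open>p\<close> is coprime to \<open>q\<close> and \<open>s < S \<le> q\<close>.\<close>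
  have Hsum: "(\<Sum>k<q. (norm (H k))\<^sup>2) = real q * real S"
  proof -
    have "s = t" if "s < S" "t < S" "[s * p = t * p] (mod q)" for s t
    proof -
      have "[s = t] (mod q)" using that(3) cop by (simp add: cong_mult_rcancel_nat)
      thus ?thesis using that(1,2) S by (simp add: cong_def)
    qed
    thus ?thesis unfolding H_def
      using sum_norm_exp_sum_squared_inj[of q "{..<S}" "\<lambda>s. s * p" "\<lambda>_. 1"] q by simp
  qed
  have Hle: "norm (H k) \<le> real (q div gcd k q)" if "k \<in> {1..<q}" for k
  proof -
    have "H k = (\<Sum>s<S. add_char q (k * p) ^ s)"
      by (simp add: H_def mult_ac flip: add_char_mult)
    also have "norm \<dots> \<le> real (q div gcd k q)"
    proof (rule linear_exp_sum_bound)
      have "q dvd (q div gcd k q) * (k * p)"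
        by (metis dvd_mult2 dvd_triv_left div_mult_swap gcd_dvd1 gcd_dvd2 mult.assoc dvd_div_mult)
      thus "add_char q (k * p) ^ (q div gcd k q) = 1"
        using q by (simp add: add_char_eq_1_iff flip: add_char_mult)
      have "\<not> q dvd k * p"
        using that cop by (auto simp: coprime_dvd_mult_left_iff coprime_commute dest: dvd_imp_le)
      thus "add_char q (k * p) \<noteq> 1" using q by (simp add: add_char_eq_1_iff)
      show "q div gcd k q > 0" using q by (simp add: div_greater_zero_iff gcd_le2_nat)
    qed simp
    finally show ?thesis .
  qed
  have Gtriv: "norm (G k) \<le> real J ^ 2" for k
  proof -
    have "norm (G k) \<le> (\<Sum>u<J. \<Sum>v<J. 1)"
      unfolding G_def by (intro sum_norm_le) (simp add: norm_mult)
    thus ?thesis by (simp add: power2_eq_square)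
  qed
  have Gle: "(norm (G k))\<^sup>2 \<le> M" if "D \<le> q div gcd k q" for k
  proof -
    let ?g = "gcd k q" and ?Q = "q div gcd k q"
    have Q: "?Q > 0" using q by (simp add: div_greater_zero_iff gcd_le2_nat)
    have "(norm (G k))\<^sup>2 \<le> real J ^ 2 * (2 * real J ^ 2 / real ?Q + 3 * real J + real ?Q)"
      unfolding G_def
      using bilinear_exp_sum_bound[of ?g ?Q "k div ?g" "\<lambda>u. add_char q (k * (2 * c * u + u\<^sup>2))"
          "\<lambda>v. add_char q (k * (2 * c * v + v\<^sup>2))" J] q Q
      by (simp add: div_gcd_coprime)
    \<comment> \<open>The reduced denominator is at least \<open>D\<close> in the first term and at
      most \<open>q\<close> in the last.\<close>
    also have "\<dots> \<le> M"
      unfolding M_def using that D Q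
      by (intro mult_left_mono add_mono divide_left_mono) auto
    finally show ?thesis .
  qed
  let ?K = "{k \<in> {1..<q}. q div gcd k q \<le> D}"
  have "(\<Sum>k\<in>{1..<q}. (norm (G k * H k))\<^sup>2) =
     (\<Sum>k\<in>?K. (norm (G k * H k))\<^sup>2) + (\<Sum>k\<in>{1..<q} - ?K. (norm (G k * H k))\<^sup>2)"
    by (rule sum.subset_diff[THEN trans]) (auto simp: add.commute)
  also have "(\<Sum>k\<in>?K. (norm (G k * H k))\<^sup>2) \<le> real (card ?K) * (real J ^ 4 * real D ^ 2)"
  proof (rule sum_bounded_above)
    fix k assume k: "k \<in> ?K"
    have "norm (H k) \<le> real D" using Hle[of k] k by (auto intro: order_trans)
    hence "(norm (G k))\<^sup>2 * (norm (H k))\<^sup>2 \<le> (real J ^ 2)\<^sup>2 * real D ^ 2"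
      using Gtriv[of k] by (intro mult_mono power_mono) auto
    thus "(norm (G k * H k))\<^sup>2 \<le> real J ^ 4 * real D ^ 2"
      by (simp add: norm_mult power_mult_distrib flip: power_mult)
  qed
  also have "\<dots> \<le> real (D\<^sup>2) * (real J ^ 4 * real D ^ 2)"
    by (intro mult_right_mono of_nat_mono card_small_denominator_le) auto
  also have "\<dots> = real D ^ 4 * real J ^ 4" by (simp add: power2_eq_square power4_eq_xxxx)
  also have "(\<Sum>k\<in>{1..<q} - ?K. (norm (G k * H k))\<^sup>2) \<le> (\<Sum>k\<in>{1..<q} - ?K. M * (norm (H k))\<^sup>2)"
    using Gle by (intro sum_mono) (auto simp: norm_mult power_mult_distrib intro!: mult_right_mono)
  also have "\<dots> \<le> (\<Sum>k<q. M * (norm (H k))\<^sup>2)"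
    using M0 by (intro sum_mono2) auto
  also have "\<dots> = M * (real q * real S)" by (simp add: Hsum flip: sum_distrib_left)
  finally show ?thesis unfolding W M_def by simp
qed

text \<open>The exponent 3/4 lies between 2/3 and 4/5: above 2/3 the term \<open>q^2 / J^3\<close>
  of the mean square tends to 0; below 4/5 the blocks are short against averages of length
  \<open>q powr (4/5)\<close> and stay within the range of rigidity.\<close>

definition block_length :: "nat \<Rightarrow> nat" where
  "block_length q = nat \<lfloor>real q powr (3/4)\<rfloor>"

lemma block_length_le: "real (block_length q) \<le> real q powr (3/4)"
  by (simp add: block_length_def)

lemma block_length_ge: "real (block_length q) \<ge> real q powr (3/4) - 1"
  by (simp add: block_length_def)

lemma block_length_le_self: "block_length q \<le> q"
proof (cases "q = 0")
  case False
  hence "real q powr (3/4) \<le> real q powr 1" by (intro powr_mono) auto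
  with block_length_le[of q] False show ?thesis by simp
qed (simp add: block_length_def)

text \<open>The threshold for \<open>q\<close> is chosen before \<open>p\<close>, \<open>c\<close>
  and \<open>F\<close>: later \<open>F\<close> depends on a point of the space and \<open>c\<close>
  on the position in the average, and the bound has to be uniform in both.\<close>

lemma quadratic_equidistribution:
  assumes B: "B > 0" and "e > 0"
  shows "\<forall>\<^sub>F q in sequentially. \<forall>p c (F :: nat \<Rightarrow> complex).
    coprime p q \<longrightarrow> (\<forall>a<q. norm (F a) \<le> B) \<longrightarrow>
    norm ((\<Sum>(u, v, s)\<in>{..<block_length q} \<times> {..<block_length q} \<times> {..<block_length q}.
             F ((2 * c * (u + v) + (u + v)\<^sup>2 + s * p) mod q)) / of_nat (block_length q) ^ 3
          - (\<Sum>a<q. F a) / of_nat q) \<le> e"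
proof -
  define \<epsilon> where "\<epsilon> = e / B"
  have \<epsilon>: "\<epsilon> > 0" "B * \<epsilon> = e" using assms by (simp_all add: \<epsilon>_def)
  \<comment> \<open>This bounds the mean square divided by \<open>J^6\<close>; the numerator
    contains the upper bound of the rounded \<open>D\<close>, the denominators contain the lower
    bounds of \<open>J\<close> and \<open>D\<close>.\<close>
  define g :: "real \<Rightarrow> real" where "g x = (x powr (3/10)) ^ 4 / (x powr (3/4) - 1)\<^sup>2
     + 2 * x / ((x powr (3/4) - 1) * (x powr (3/10) - 1)) + 3 * x / (x powr (3/4) - 1)\<^sup>2
     + x\<^sup>2 / (x powr (3/4) - 1) ^ 3" for x
  have "(g \<longlongrightarrow> 0) at_top" unfolding g_def by real_asymp
  hence "\<forall>\<^sub>F x in at_top. g x < \<epsilon>\<^sup>2" using \<epsilon> by (intro order_tendstoD) auto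
  moreover have "\<forall>\<^sub>F x in at_top. x powr (3/4) > (2::real)" "\<forall>\<^sub>F x in at_top. x powr (3/10) > (2::real)"
    by real_asymp+
  ultimately have "\<forall>\<^sub>F x in at_top. g x < \<epsilon>\<^sup>2 \<and> x powr (3/4) > (2::real) \<and> x powr (3/10) > (2::real)"
    by eventually_elim auto
  hence "\<forall>\<^sub>F q in sequentially. g (real q) < \<epsilon>\<^sup>2 \<and> real q powr (3/4) > 2 \<and> real q powr (3/10) > 2"
    by (rule eventually_compose_filterlim) (rule filterlim_real_sequentially)
  thus ?thesis
  proof (eventually_elim, intro allI impI)
    fix q p c :: nat and F :: "nat \<Rightarrow> complex"
    assume *: "g (real q) < \<epsilon>\<^sup>2 \<and> real q powr (3/4) > 2 \<and> real q powr (3/10) > 2"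
      and cop: "coprime p q" and F: "\<forall>a<q. norm (F a) \<le> B"
    have q: "q > 0" using * by (cases "q = 0") auto
    define J where "J = block_length q"
    \<comment> \<open>With \<open>J\<close> of size \<open>q powr (3/4)\<close>, the term
      \<open>D^4 / J^2\<close> requires an exponent below 3/8 and \<open>q / (J * D)\<close> one
      above 1/4; 3/10 lies between.\<close>
    define D where "D = nat \<lfloor>real q powr (3/10)\<rfloor>"
    define x where "x = real q"
    have J: "real J \<ge> x powr (3/4) - 1" using block_length_ge[of q] by (simp add: J_def x_def)
    have D: "real D \<ge> x powr (3/10) - 1" "real D \<le> x powr (3/10)"
      by (simp_all add: D_def x_def)
    have x: "g x < \<epsilon>\<^sup>2" "x powr (3/4) > 2" "x powr (3/10) > 2" "x > 0" using * q by (auto simp: x_def)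
    have pos: "real J > 0" "real D > 0" "x powr (3/4) - 1 > 0" "x powr (3/10) - 1 > 0" using J D x by linarith+
    define X where "X = {..<J} \<times> {..<J} \<times> {..<J}"
    define E where "E = (\<Sum>k\<in>{1..<q}. (norm (\<Sum>(u, v, s)\<in>X.
            add_char q (k * (2 * c * (u + v) + (u + v)\<^sup>2 + s * p))))\<^sup>2)"
    have "E \<le> real D ^ 4 * real J ^ 4
            + real J ^ 2 * (2 * real J ^ 2 / real D + 3 * real J + real q) * (real q * real J)"
      unfolding E_def X_def
      using pos q cop block_length_le_self[of q]
      by (intro quadratic_exp_sum_mean_square) (auto simp: J_def)
    also have "\<dots> = real J ^ 6 * (real D ^ 4 / (real J)\<^sup>2 + 2 * x / (real J * real D) + 3 * x / (real J)\<^sup>2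
       + x\<^sup>2 / real J ^ 3)"
      using pos by (simp add: x_def field_simps eval_nat_numeral)
    also have "\<dots> \<le> real J ^ 6 * g x"
      unfolding g_def using J D pos x(4)
      by (intro mult_left_mono add_mono frac_le power_mono mult_mono) auto
    also have "\<dots> \<le> real J ^ 6 * \<epsilon>\<^sup>2" using x pos by (intro mult_left_mono) auto
    also have "\<dots> = (real J ^ 3 * \<epsilon>)\<^sup>2" by (simp add: power_mult_distrib flip: power_mult)
    finally have "sqrt E \<le> real J ^ 3 * \<epsilon>"
      using pos \<epsilon> by (intro real_le_lsqrt) (auto simp: E_def sum_nonneg)
    hence BE: "B * sqrt E \<le> B * (real J ^ 3 * \<epsilon>)" using B by (intro mult_left_mono) auto
    define Sg where "Sg = (\<Sum>(u, v, s)\<in>X. F ((2 * c * (u + v) + (u + v)\<^sup>2 + s * p) mod q))"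
    define A where "A = (\<Sum>a<q. F a) / of_nat q"
    have "card X = J ^ 3" by (simp add: X_def power3_eq_cube)
    moreover have "finite X" by (simp add: X_def)
    ultimately have "norm (Sg - of_nat J ^ 3 * A) \<le> B * sqrt E"
      using equidistribution_defect[OF q, of X F B "\<lambda>(u, v, s). 2 * c * (u + v) + (u + v)\<^sup>2 + s * p"] F
      by (simp add: Sg_def A_def E_def case_prod_unfold)
    hence "norm (Sg - of_nat J ^ 3 * A) \<le> B * (real J ^ 3 * \<epsilon>)" using BE by linarith
    moreover have "Sg / of_nat J ^ 3 - A = (Sg - of_nat J ^ 3 * A) / of_nat J ^ 3"
      using pos by (simp add: field_simps)
    ultimately have "norm (Sg / of_nat J ^ 3 - A) \<le> B * \<epsilon>"
      using pos by (simp add: norm_divide norm_power field_simps)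
    thus "norm ((\<Sum>(u, v, s)\<in>{..<block_length q} \<times> {..<block_length q} \<times> {..<block_length q}.
             F ((2 * c * (u + v) + (u + v)\<^sup>2 + s * p) mod q)) / of_nat (block_length q) ^ 3
          - (\<Sum>a<q. F a) / of_nat q) \<le> e"
      by (simp add: Sg_def A_def X_def J_def \<epsilon>)
  qed
qed

section \<open>Unique ergodicity and uniform convergence\<close>

lemma compact_separating_sequence:
  assumes "compact (UNIV :: 'a::metric_space set)"
  obtains A :: "nat \<Rightarrow> 'a::metric_space set"
  where "\<And>\<epsilon>. \<epsilon> > 0 \<Longrightarrow> \<exists>n. \<forall>x. \<exists>k<n. x \<in> A k \<and> (\<forall>y\<in>A k. dist x y < \<epsilon>)"
proof -
  have "\<exists>C. finite C \<and> (\<Union>c\<in>C. ball c (1 / real (Suc m))) = (UNIV :: 'a set)" for m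
  proof -
    have "1 / real (Suc m) > 0" by simp
    then obtain C :: "'a set" where "finite C" "UNIV \<subseteq> (\<Union>c\<in>C. ball c (1 / real (Suc m)))"
      using assms unfolding compact_eq_totally_bounded by blast
    thus ?thesis by (intro exI[of _ C]) auto
  qed
  then obtain C :: "nat \<Rightarrow> 'a set" where C: "\<And>m. finite (C m)" "\<And>m. (\<Union>c\<in>C m. ball c (1 / real (Suc m))) = UNIV"
    by metis
  define \<A> where "\<A> = (\<Union>m. (\<lambda>c. ball c (1 / real (Suc m))) ` C m)"
  define A where "A = from_nat_into \<A>"
  have "countable \<A>" unfolding \<A>_def by (intro countable_UN countable_image countable_finite[OF C(1)]) simp
  have idx: "\<exists>k. A k = S" if "S \<in> \<A>" for S
    unfolding A_def using \<open>countable \<A>\<close> that by (rule from_nat_into_surj)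
  have "\<exists>n. \<forall>x. \<exists>k<n. x \<in> A k \<and> (\<forall>y\<in>A k. dist x y < \<epsilon>)" if \<epsilon>: "\<epsilon> > 0" for \<epsilon>
  proof -
    obtain m where m: "1 / real (Suc m) < \<epsilon> / 2"
      using nat_approx_posE[OF half_gt_zero[OF \<epsilon>]] by blast
    let ?B = "\<lambda>c. ball c (1 / real (Suc m))"
    have "\<forall>c\<in>C m. \<exists>k. A k = ?B c" using idx unfolding \<A>_def by blast
    then obtain k where k: "\<And>c. c \<in> C m \<Longrightarrow> A (k c) = ?B c" by metis
    \<comment> \<open>One finite net serves all \<open>x\<close>, so the largest index of its balls
      gives a bound independent of \<open>x\<close>.\<close>
    show ?thesis
    proof (rule exI[of _ "Suc (Max (k ` C m))"], rule allI)
      fix x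
      obtain c where c: "c \<in> C m" "x \<in> ?B c" using C(2)[of m] by blast
      have "dist x y < \<epsilon>" if "y \<in> ?B c" for y
        using c(2) that m dist_triangle2[of x y c] by (simp add: dist_commute)
      moreover have "k c < Suc (Max (k ` C m))" using c C(1) by (simp add: less_Suc_eq_le)
      ultimately show "\<exists>j<Suc (Max (k ` C m)). x \<in> A j \<and> (\<forall>y\<in>A j. dist x y < \<epsilon>)"
        using c(2) by (intro exI[of _ "k c"]) (simp add: k[OF c(1)])
    qed
  qed
  thus ?thesis using that by blast
qed

text \<open>A point of the Cantor set, with digits 0 and 2 in base 3. Omitting the digit 1 leaves
  gaps, so that nearby values have equal initial digits, which fails for binary expansions.\<close>

definition ternary :: "(nat \<Rightarrow> bool) \<Rightarrow> real" where
  "ternary b = (\<Sum>k. of_bool (b k) * (2 / 3 ^ Suc k))"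

lemma ternary_weights_sums: "(\<lambda>k. 2 / 3 ^ Suc k :: real) sums 1"
proof -
  have "(\<lambda>k. 2 / 3 * (1 / 3) ^ k :: real) sums (2 / 3 * (1 / (1 - 1 / 3)))"
    by (intro sums_mult geometric_sums) simp
  thus ?thesis by (simp add: power_one_over)
qed

lemma summable_ternary: "summable (\<lambda>k. of_bool (b k) * (2 / 3 ^ Suc k) :: real)"
  by (rule summable_comparison_test'[OF sums_summable[OF ternary_weights_sums], of 0]) auto

lemma ternary_range: "0 \<le> ternary b" "ternary b \<le> 1"
proof -
  show "0 \<le> ternary b" unfolding ternary_def by (intro suminf_nonneg summable_ternary) auto
  have "ternary b \<le> (\<Sum>k. 2 / 3 ^ Suc k)" unfolding ternary_def
    by (intro suminf_le summable_ternary sums_summable[OF ternary_weights_sums]) auto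
  thus "ternary b \<le> 1" using ternary_weights_sums by (simp only: sums_iff)
qed

text \<open>At the first index \<open>m\<close> of disagreement the two series differ by
  \<open>2 / 3 ^ Suc m\<close>, while the tails after it can restore at most
  \<open>1 / 3 ^ Suc m\<close>.\<close>

lemma ternary_separates:
  assumes "\<bar>ternary b - ternary c\<bar> < 1 / 3 ^ n" "k < n"
  shows "b k = c k"
proof (rule ccontr)
  assume "b k \<noteq> c k"
  define m where "m = (LEAST m. b m \<noteq> c m)"
  have m: "b m \<noteq> c m" "m \<le> k" "\<And>j. j < m \<Longrightarrow> b j = c j"
    unfolding m_def using LeastI[of "\<lambda>m. b m \<noteq> c m", OF \<open>b k \<noteq> c k\<close>]
      Least_le[of "\<lambda>m. b m \<noteq> c m", OF \<open>b k \<noteq> c k\<close>] not_less_Least[of _ "\<lambda>m. b m \<noteq> c m"] by blast+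
  define d where "d j = (of_bool (b j) - of_bool (c j)) * (2 / 3 ^ Suc j :: real)" for j
  have d: "summable d" "suminf d = ternary b - ternary c"
    unfolding d_def ternary_def left_diff_distrib
    by (intro summable_diff summable_ternary suminf_diff[symmetric])+
  have "suminf d = (\<Sum>j. d (j + Suc m)) + (\<Sum>j<Suc m. d j)"
    by (rule suminf_split_initial_segment) fact
  moreover have "(\<Sum>j<Suc m. d j) = d m" using m(3) by (simp add: d_def)
  moreover have "\<bar>d m\<bar> = 2 * (1 / 3 ^ Suc m)" using m(1) by (auto simp: d_def abs_mult)
  moreover have "\<bar>\<Sum>j. d (j + Suc m)\<bar> \<le> 1 / 3 ^ Suc m"
  proof -
    have s: "(\<lambda>j. 1 / 3 ^ Suc m * (2 / 3 ^ Suc j) :: real) sums (1 / 3 ^ Suc m * 1)"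
      by (intro sums_mult ternary_weights_sums)
    have "norm (\<Sum>j. d (j + Suc m)) \<le> (\<Sum>j. 1 / 3 ^ Suc m * (2 / 3 ^ Suc j))"
      by (rule norm_suminf_le[OF _ sums_summable[OF s]])
         (auto simp: d_def abs_mult power_add divide_simps of_bool_def)
    thus ?thesis using s by (simp add: sums_iff)
  qed
  ultimately have "\<bar>ternary b - ternary c\<bar> \<ge> 1 / 3 ^ Suc m" using d(2) by linarith
  moreover have "(1 / 3 ^ n :: real) \<le> 1 / 3 ^ Suc m"
    using m(2) assms(2) by (intro divide_left_mono power_increasing) auto
  ultimately show False using assms(1) by linarith
qed

text \<open>
  The code \<open>\<phi>\<close> is not continuous; only its inverse is, which suffices to carry weak limits of
  finitely supported measures from the real line, where Helly's theorem yields them, to \<open>'a\<close>.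
\<close>

lemma compact_metric_code:
  assumes "compact (UNIV :: 'a::metric_space set)"
  obtains \<phi> :: "'a::metric_space \<Rightarrow> real" and \<pi> :: "real \<Rightarrow> 'a::metric_space"
  where "\<And>x. \<phi> x \<in> {0..1}" "continuous_on (closure (range \<phi>)) \<pi>" "\<And>x. \<pi> (\<phi> x) = x"
proof -
  obtain A :: "nat \<Rightarrow> 'a set"
    where A: "\<And>\<epsilon>. \<epsilon> > 0 \<Longrightarrow> \<exists>n. \<forall>x. \<exists>k<n. x \<in> A k \<and> (\<forall>y\<in>A k. dist x y < \<epsilon>)"
    using compact_separating_sequence[OF assms] by blast
  define \<phi> where "\<phi> x = ternary (\<lambda>k. x \<in> A k)" for x
  \<comment> \<open>Codes agreeing in the first \<open>n\<close> digits put both points into a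
    common small set \<open>A k\<close>; so the inverse of \<open>\<phi>\<close> is uniformly
    continuous.\<close>
  have sep: "\<exists>\<delta>>0. \<forall>x y. \<bar>\<phi> x - \<phi> y\<bar> < \<delta> \<longrightarrow> dist x y < \<epsilon>" if \<epsilon>: "\<epsilon> > 0" for \<epsilon>
  proof -
    obtain n where n: "\<And>x. \<exists>k<n. x \<in> A k \<and> (\<forall>y\<in>A k. dist x y < \<epsilon>)" using A[OF \<epsilon>] by blast
    have "dist x y < \<epsilon>" if "\<bar>\<phi> x - \<phi> y\<bar> < 1 / 3 ^ n" for x y
      using n[of x] ternary_separates[OF that[unfolded \<phi>_def]] by blast
    thus ?thesis by (intro exI[of _ "1 / 3 ^ n"]) auto
  qed
  \<comment> \<open>The closure of the graph of the inverse of \<open>\<phi>\<close>: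
    \<open>near t z\<close> means that some points with codes tending to \<open>t\<close> converge
    to \<open>z\<close>.\<close>
  define near where "near t z \<longleftrightarrow> (\<forall>\<epsilon>>0. \<exists>y. dist z y < \<epsilon> \<and> \<bar>\<phi> y - t\<bar> < \<epsilon>)" for t z
  define \<pi> where "\<pi> t = (SOME z. near t z)" for t
  have near: "near t (\<pi> t)" if t: "t \<in> closure (range \<phi>)" for t
  proof -
    obtain s where s: "\<forall>n. s n \<in> range \<phi>" "s \<longlonglongrightarrow> t"
      using t unfolding closure_sequential by blast
    define x where "x n = inv \<phi> (s n)" for n
    have x: "s n = \<phi> (x n)" for n using s(1) by (simp add: x_def f_inv_into_f)
    have "\<forall>n. x n \<in> UNIV" by simp
    with assms have "\<exists>z\<in>UNIV. \<exists>r. strict_mono r \<and> (x \<circ> r) \<longlonglongrightarrow> z"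
      unfolding compact_def by blast
    then obtain z r where r: "strict_mono r" "(x \<circ> r) \<longlonglongrightarrow> z" by blast
    have lim: "(\<lambda>n. \<phi> (x (r n))) \<longlonglongrightarrow> t"
      using LIMSEQ_subseq_LIMSEQ[OF s(2) r(1)] by (simp add: o_def x)
    have "near t z" unfolding near_def
    proof (intro allI impI)
      fix \<epsilon> :: real assume "\<epsilon> > 0"
      have "\<forall>\<^sub>F n in sequentially. dist (x (r n)) z < \<epsilon>" 
        using tendstoD[OF r(2) \<open>\<epsilon> > 0\<close>] by simp
      moreover have "\<forall>\<^sub>F n in sequentially. dist (\<phi> (x (r n))) t < \<epsilon>"
        using tendstoD[OF lim \<open>\<epsilon> > 0\<close>] .
      ultimately have "\<forall>\<^sub>F n in sequentially. dist (x (r n)) z < \<epsilon> \<and> dist (\<phi> (x (r n))) t < \<epsilon>"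
        by eventually_elim auto
      then obtain n where "dist (x (r n)) z < \<epsilon> \<and> dist (\<phi> (x (r n))) t < \<epsilon>"
        using eventually_happens'[OF sequentially_bot] by blast
      thus "\<exists>y. dist z y < \<epsilon> \<and> \<bar>\<phi> y - t\<bar> < \<epsilon>" by (auto simp: dist_commute dist_real_def)
    qed
    thus ?thesis unfolding \<pi>_def by (rule someI)
  qed
  \<comment> \<open>For \<open>t = t'\<close> this says that the limit point is unique, so the
    choice in \<open>\<pi>\<close> is harmless; for \<open>t\<close> close to \<open>t'\<close> it
    gives continuity of \<open>\<pi>\<close>.\<close>
  have close: "\<exists>\<delta>>0. \<forall>t t' z z'. \<bar>t - t'\<bar> < \<delta> \<longrightarrow> near t z \<longrightarrow> near t' z' \<longrightarrow> dist z z' < \<epsilon>"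
    if \<epsilon>: "\<epsilon> > 0" for \<epsilon>
  proof -
    obtain \<delta> where \<delta>: "\<delta> > 0" "\<And>x y. \<bar>\<phi> x - \<phi> y\<bar> < \<delta> \<Longrightarrow> dist x y < \<epsilon> / 3"
      using sep[of "\<epsilon> / 3"] \<epsilon> by auto
    have "dist z z' < \<epsilon>" if tt: "\<bar>t - t'\<bar> < \<delta> / 3" and z: "near t z" "near t' z'" for t t' z z'
    proof -
      have e: "min (\<epsilon> / 3) (\<delta> / 3) > 0" using \<epsilon> \<delta>(1) by simp
      obtain y where y: "dist z y < min (\<epsilon> / 3) (\<delta> / 3)" "\<bar>\<phi> y - t\<bar> < min (\<epsilon> / 3) (\<delta> / 3)"
        using z(1) e unfolding near_def by blast
      obtain y' where y': "dist z' y' < min (\<epsilon> / 3) (\<delta> / 3)" "\<bar>\<phi> y' - t'\<bar> < min (\<epsilon> / 3) (\<delta> / 3)"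
        using z(2) e unfolding near_def by blast
      have "\<bar>\<phi> y - \<phi> y'\<bar> < \<delta>" using tt y(2) y'(2) by linarith
      hence "dist y y' < \<epsilon> / 3" by (rule \<delta>(2))
      thus ?thesis using y(1) y'(1) dist_triangle[of z z' y] dist_triangle[of y z' y'] 
        by (simp add: dist_commute)
    qed
    thus ?thesis using \<delta>(1) by (intro exI[of _ "\<delta> / 3"]) auto
  qed
  show thesis
  proof
    show "\<phi> x \<in> {0..1}" for x using ternary_range by (simp add: \<phi>_def)
    show "continuous_on (closure (range \<phi>)) \<pi>"
      unfolding continuous_on_iff
    proof (intro ballI allI impI)
      fix t \<epsilon> :: real assume t: "t \<in> closure (range \<phi>)" and \<epsilon>: "\<epsilon> > 0"
      obtain \<delta> where \<delta>: "\<delta> > 0"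
        "\<And>t t' z z'. \<bar>t - t'\<bar> < \<delta> \<Longrightarrow> near t z \<Longrightarrow> near t' z' \<Longrightarrow> dist z z' < \<epsilon>"
        using close[OF \<epsilon>] by blast
      have "dist (\<pi> t') (\<pi> t) < \<epsilon>" if "t' \<in> closure (range \<phi>)" "dist t' t < \<delta>" for t'
        using \<delta>(2)[of t' t] near[OF t] near[OF that(1)] that(2) by (simp add: dist_real_def)
      with \<delta>(1) show "\<exists>d>0. \<forall>t'\<in>closure (range \<phi>). dist t' t < d \<longrightarrow> dist (\<pi> t') (\<pi> t) < \<epsilon>"
        by blast
    qed
    show "\<pi> (\<phi> x) = x" for x
    proof -
      have n1: "near (\<phi> x) x" unfolding near_def
        by (intro allI impI exI[of _ x]) auto
      have n2: "near (\<phi> x) (\<pi> (\<phi> x))" using closure_subset[of "range \<phi>"] by (intro near) auto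
      have "dist (\<pi> (\<phi> x)) x < \<epsilon>" if \<epsilon>: "\<epsilon> > 0" for \<epsilon>
      proof -
        obtain \<delta> where \<delta>: "\<delta> > 0"
          "\<And>t t' z z'. \<bar>t - t'\<bar> < \<delta> \<Longrightarrow> near t z \<Longrightarrow> near t' z' \<Longrightarrow> dist z z' < \<epsilon>"
          using close[OF \<epsilon>] by blast
        show ?thesis by (rule \<delta>(2)[OF _ n2 n1]) (simp add: \<delta>(1))
      qed
      from this[of "dist (\<pi> (\<phi> x)) x"] show ?thesis by (cases "\<pi> (\<phi> x) = x") auto
    qed
  qed
qed

section \<open>Weak limits of probability measures\<close>

lemma compact_continuous_bounded:
  fixes h :: "'a::metric_space \<Rightarrow> 'b::real_normed_vector"
  assumes "compact (UNIV :: 'a set)" "continuous_on UNIV h"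
  obtains B where "B > 0" "\<And>x. norm (h x) \<le> B"
proof -
  have "bounded (range h)" using compact_continuous_image[OF assms(2,1)] by (rule compact_imp_bounded)
  thus thesis using that unfolding bounded_pos by auto
qed

text \<open>Pushed forward along the code \<open>\<phi>\<close>, the measures live in
  \<open>{0..1}\<close> and are tight, so Helly's theorem supplies a limit on the line, and the
  continuous \<open>\<pi>\<close> carries it back. Every function is measurable on a
  \<open>measure_pmf\<close>, which accommodates a discontinuous \<open>\<phi>\<close>.\<close>

lemma pmf_weak_limit:
  fixes p :: "nat \<Rightarrow> 'a::metric_space pmf"
  assumes cpt: "compact (UNIV :: 'a set)"
  shows "\<exists>(r :: nat \<Rightarrow> nat) (M :: 'a measure). strict_mono r \<and> prob_space M \<and> sets M = sets borel \<and>
    (\<forall>h :: 'a \<Rightarrow> real. continuous_on UNIV h \<longrightarrow>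
       (\<lambda>n. \<integral>x. h x \<partial>measure_pmf (p (r n))) \<longlonglongrightarrow> (\<integral>x. h x \<partial>M))"
proof -
  obtain \<phi> :: "'a \<Rightarrow> real" and \<pi> :: "real \<Rightarrow> 'a"
    where \<phi>: "\<And>x. \<phi> x \<in> {0..1}" and \<pi>: "continuous_on (closure (range \<phi>)) \<pi>" "\<And>x. \<pi> (\<phi> x) = x"
    using compact_metric_code[OF cpt] by blast
  define K where "K = closure (range \<phi>)"
  have K: "closed K" "K \<noteq> {}" "\<And>x. \<phi> x \<in> K"
    unfolding K_def using closure_subset[of "range \<phi>"] by auto
  define \<nu> where "\<nu> n = distr (measure_pmf (p n)) borel \<phi>" for n
  have rd: "real_distribution (\<nu> n)" for n
    unfolding \<nu>_def by (rule prob_space.real_distribution_distr[OF prob_space_measure_pmf]) simp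
  have int\<nu>: "(\<integral>t. g t \<partial>\<nu> n) = (\<integral>x. g (\<phi> x) \<partial>measure_pmf (p n))"
    if "continuous_on UNIV g" for g :: "real \<Rightarrow> real" and n
    unfolding \<nu>_def by (rule integral_distr) (use borel_measurable_continuous_onI[OF that] in auto)
  have "tight \<nu>"
    unfolding tight_def
  proof (intro conjI allI impI rd)
    fix \<epsilon> :: real assume "\<epsilon> > 0"
    \<comment> \<open>Tightness is stated with left-open intervals, so the left end is placed below
      the possible code 0.\<close>
    have "measure (\<nu> n) {-1<..1} = 1" for n
    proof -
      have "\<phi> -` {-1<..1} = UNIV" using \<phi> by (force intro: less_le_trans[of "-1" 0])
      thus ?thesis unfolding \<nu>_def by (subst measure_distr) auto
    qed
    thus "\<exists>a b. a < b \<and> (\<forall>n. measure (\<nu> n) {a<..b} > 1 - \<epsilon>)"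
      using \<open>\<epsilon> > 0\<close> by (intro exI[of _ "-1"] exI[of _ 1]) auto
  qed
  then obtain r L where r: "strict_mono (r :: nat \<Rightarrow> nat)" and L: "real_distribution L"
    and conv: "weak_conv_m (\<nu> \<circ> id \<circ> r) L"
    using tight_imp_convergent_subsubsequence[OF _ strict_mono_id] by blast
  interpret L: real_distribution L by fact
  have lim: "(\<lambda>n. \<integral>x. g (\<phi> x) \<partial>measure_pmf (p (r n))) \<longlonglongrightarrow> (\<integral>t. g t \<partial>L)"
    if g: "continuous_on UNIV g" and B: "\<And>t. norm (g t) \<le> B" for g :: "real \<Rightarrow> real" and B
  proof -
    have "(\<lambda>n. integral\<^sup>L ((\<nu> \<circ> id \<circ> r) n) g) \<longlonglongrightarrow> integral\<^sup>L L g"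
      using rd L conv g B
      by (intro weak_conv_imp_integral_bdd_continuous_conv) (auto simp: continuous_on_eq_continuous_at o_def)
    thus ?thesis using int\<nu>[OF g] by simp
  qed
  \<comment> \<open>The truncated distance to \<open>K\<close> is a bounded continuous test function
    vanishing at all codes, so its integral against the limit is 0.\<close>
  have inK: "AE t in L. t \<in> K"
  proof -
    let ?g = "\<lambda>t. min 1 (infdist t K)"
    have cont: "continuous_on UNIV ?g" by (intro continuous_intros)
    have bd: "norm (?g t) \<le> 1" for t using infdist_nonneg[of t K] by auto
    have "(\<integral>t. ?g t \<partial>L) = 0"
      using LIMSEQ_unique[OF lim[OF cont bd]] K by simp
    moreover have "integrable L ?g"
      using bd borel_measurable_continuous_onI[OF cont] by (intro L.integrable_const_bound[of _ 1]) auto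
    ultimately have "AE t in L. ?g t = 0"
      using integral_nonneg_eq_0_iff_AE[of L ?g] infdist_nonneg[of _ K] by simp
    thus ?thesis
    proof eventually_elim
      case (elim t)
      hence "infdist t K = 0" by (auto simp: min_def split: if_splits)
      thus ?case using K in_closed_iff_infdist_zero by blast
    qed
  qed
  \<comment> \<open>\<open>\<pi>\<close> is known to be continuous only on \<open>K\<close>; a
    constant value off \<open>K\<close>, on a null set of \<open>L\<close>, makes it Borel
    measurable on the whole line.\<close>
  define \<pi>' where "\<pi>' t = (if t \<in> K then \<pi> t else undefined)" for t
  have meas: "\<pi>' \<in> measurable L borel"
  proof -
    have "\<pi>' \<in> borel_measurable borel" unfolding \<pi>'_def
      using K \<pi>(1) by (intro borel_measurable_continuous_on_if) (auto simp: K_def)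
    thus ?thesis by simp
  qed
  have "(\<lambda>n. \<integral>x. h x \<partial>measure_pmf (p (r n))) \<longlonglongrightarrow> (\<integral>x. h x \<partial>distr L borel \<pi>')"
    if h: "continuous_on UNIV h" for h :: "'a \<Rightarrow> real"
  proof -
    obtain B where B: "B > 0" "\<And>x. norm (h x) \<le> B" using compact_continuous_bounded[OF cpt h] by blast
    have "continuous_on K (\<lambda>t. h (\<pi> t))"
      using continuous_on_compose2[OF h \<pi>(1)] by (simp add: K_def)
    \<comment> \<open>Tietze's theorem extends the test function from \<open>K\<close> to the line
      with the same bound, as weak convergence on the line requires.\<close>
    then obtain g where g: "continuous_on UNIV g" "\<And>t. t \<in> K \<Longrightarrow> g t = h (\<pi> t)" "\<And>t. norm (g t) \<le> B"
      using Tietze[of K "\<lambda>t. h (\<pi> t)" UNIV B] K(1) B by (auto simp: less_imp_le)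
    have "(\<lambda>n. \<integral>x. g (\<phi> x) \<partial>measure_pmf (p (r n))) \<longlonglongrightarrow> (\<integral>t. g t \<partial>L)"
      by (rule lim[OF g(1,3)])
    moreover have "g (\<phi> x) = h x" for x using g(2) K(3) \<pi>(2) by simp
    moreover have "(\<integral>t. g t \<partial>L) = (\<integral>t. h (\<pi>' t) \<partial>L)"
    proof (rule integral_cong_AE)
      show "AE t in L. g t = h (\<pi>' t)" using inK by eventually_elim (simp add: g(2) \<pi>'_def)
      show "(\<lambda>t. h (\<pi>' t)) \<in> borel_measurable L"
        using meas borel_measurable_continuous_onI[OF h] by (rule measurable_compose)
      show "g \<in> borel_measurable L" using borel_measurable_continuous_onI[OF g(1)] by simp
    qed
    moreover have "(\<integral>t. h (\<pi>' t) \<partial>L) = (\<integral>x. h x \<partial>distr L borel \<pi>')"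
      by (rule integral_distr[symmetric, OF meas borel_measurable_continuous_onI[OF h]])
    ultimately show ?thesis by simp
  qed
  moreover have "prob_space (distr L borel \<pi>')" by (rule L.prob_space_distr[OF meas])
  moreover have "sets (distr L borel \<pi>') = sets borel" by simp
  ultimately show ?thesis using r by blast
qed

text \<open>Closed sets form an intersection-stable generator of the Borel sets, and the indicator
  of a closed set is a bounded pointwise limit of continuous functions, so dominated convergence
  applies.\<close>

lemma measure_eqI_continuous_integrals:
  fixes M N :: "'a::metric_space measure"
  assumes M: "prob_space M" "sets M = sets borel" and N: "prob_space N" "sets N = sets borel"
    and eq: "\<And>h :: 'a \<Rightarrow> real. continuous_on UNIV h \<Longrightarrow> bounded (range h) \<Longrightarrow> (\<integral>x. h x \<partial>M) = (\<integral>x. h x \<partial>N)"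
  shows "M = N"
proof -
  have closed_eq: "emeasure M C = emeasure N C" if C: "closed C" for C
  proof (cases "C = {}")
    case False
    \<comment> \<open>For positive \<open>n\<close>, \<open>h n\<close> is 1 on \<open>C\<close> and
      0 at distance \<open>1 / n\<close> and beyond. The empty set is treated apart because
      \<open>infdist x {} = 0\<close>.\<close>
    define h where "h n x = max 0 (1 - real n * infdist x C)" for n x
    have cont: "continuous_on UNIV (h n)" for n unfolding h_def by (intro continuous_intros)
    have bd: "norm (h n x) \<le> 1" for n x using infdist_nonneg[of x C] by (auto simp: h_def)
    have lim: "(\<lambda>n. h n x) \<longlonglongrightarrow> indicator C x" for x
    proof (cases "x \<in> C")
      case True thus ?thesis by (simp add: h_def)
    next
      case notin: False
      have "infdist x C > 0" using notin C False in_closed_iff_infdist_zero infdist_nonneg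
        by (metis less_eq_real_def)
      then obtain m where m: "real m * infdist x C > 1" using ex_less_of_nat_mult by blast
      have "\<forall>\<^sub>F n in sequentially. h n x = 0"
      proof (rule eventually_sequentiallyI[of m])
        fix n assume "m \<le> n"
        hence "real m * infdist x C \<le> real n * infdist x C" by (intro mult_right_mono infdist_nonneg) simp
        with m show "h n x = 0" by (simp add: h_def)
      qed
      thus ?thesis using notin by (simp add: tendsto_eventually)
    qed
    have conv: "(\<lambda>n. \<integral>x. h n x \<partial>P) \<longlonglongrightarrow> measure P C" if P: "prob_space P" "sets P = sets borel" for P
    proof -
      interpret P: prob_space P by fact
      have "(\<lambda>n. \<integral>x. h n x \<partial>P) \<longlonglongrightarrow> (\<integral>x. indicator C x \<partial>P)"
      proof (rule integral_dominated_convergence[where w="\<lambda>_. 1"])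
        show "indicator C \<in> borel_measurable P"
          using C P(2) by (intro borel_measurable_indicator) auto
        show "h n \<in> borel_measurable P" for n
          using borel_measurable_continuous_onI[OF cont] P(2) by (simp cong: measurable_cong_sets)
      qed (use lim bd in auto)
      moreover have "space P = UNIV" using sets_eq_imp_space_eq[OF P(2)] by simp
      ultimately show ?thesis using C P(2) by simp
    qed
    have "(\<integral>x. h n x \<partial>M) = (\<integral>x. h n x \<partial>N)" for n
      by (rule eq[OF cont]) (use bd in \<open>auto simp: bounded_iff\<close>)
    hence "measure M C = measure N C"
      using conv[OF M] conv[OF N] LIMSEQ_unique by auto
    thus ?thesis
      using M(1) N(1) by (simp add: finite_measure.emeasure_eq_measure prob_space.finite_measure)
  qed simp
  show ?thesis
  proof (rule measure_eqI_generator_eq[where E="Collect closed" and \<Omega>=UNIV and A="\<lambda>_. UNIV"])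
    show "Int_stable (Collect closed)" by (auto simp: Int_stable_def)
    show "sets M = sigma_sets UNIV (Collect closed)" "sets N = sigma_sets UNIV (Collect closed)"
      using M(2) N(2) by (simp_all add: borel_eq_closed)
    show "emeasure M UNIV \<noteq> \<infinity>"
      using finite_measure.emeasure_finite[OF prob_space.finite_measure[OF M(1)]] by simp
    show "emeasure M C = emeasure N C" if "C \<in> Collect closed" for C
      using that closed_eq by simp
  qed simp_all
qed

text \<open>If uniformity failed, the empirical measures of orbit segments with bad averages would
  have a weak limit point. It is invariant, since a segment and its shift differ only at the two
  ends, hence equals \<open>\<mu>\<close>; but the bad averages stay away from the integral against
  \<open>\<mu>\<close>.\<close>

lemma uniquely_ergodic_uniform_convergence_real:
  fixes T :: "'a::metric_space \<Rightarrow> 'a" and h :: "'a \<Rightarrow> real"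
  assumes cpt: "compact (UNIV :: 'a set)" and T: "continuous_on UNIV T"
    and ue: "uniquely_ergodic T" and \<mu>: "invariant_borel_prob T \<mu>"
    and h: "continuous_on UNIV h" and "\<epsilon> > 0"
  shows "\<forall>\<^sub>F n in sequentially. \<forall>x. \<bar>(\<Sum>i<n. h ((T ^^ i) x)) / real n - (\<integral>y. h y \<partial>\<mu>)\<bar> < \<epsilon>"
proof (rule ccontr)
  assume "\<not> ?thesis"
  hence "\<forall>m. \<exists>n x. n \<ge> Suc m \<and> \<bar>(\<Sum>i<n. h ((T ^^ i) x)) / real n - (\<integral>y. h y \<partial>\<mu>)\<bar> \<ge> \<epsilon>"
    unfolding eventually_sequentially by (auto simp: not_less)
  then obtain n x where n: "\<And>m. n m \<ge> Suc m"
    and far: "\<And>m. \<bar>(\<Sum>i<n m. h ((T ^^ i) (x m))) / real (n m) - (\<integral>y. h y \<partial>\<mu>)\<bar> \<ge> \<epsilon>"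
    by metis
  define p where "p m = map_pmf (\<lambda>i. (T ^^ i) (x m)) (pmf_of_set {..<n m})" for m
  have n0: "n m > 0" for m using n[of m] by simp
  have avg: "(\<integral>y. g y \<partial>measure_pmf (p m)) = (\<Sum>i<n m. g ((T ^^ i) (x m))) / real (n m)"
    for g :: "'a \<Rightarrow> real" and m
      proof -
    have "{..<n m} \<noteq> {}" using n0[of m] by auto
    thus ?thesis unfolding p_def integral_map_pmf by (subst integral_pmf_of_set) auto
  qed
  obtain r M where r: "strict_mono (r :: nat \<Rightarrow> nat)" and M: "prob_space M" "sets M = sets borel"
    and lim': "\<forall>g :: 'a \<Rightarrow> real. continuous_on UNIV g \<longrightarrow>
      (\<lambda>k. \<integral>y. g y \<partial>measure_pmf (p (r k))) \<longlonglongrightarrow> (\<integral>y. g y \<partial>M)"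
    using pmf_weak_limit[OF cpt, of p] by (elim exE conjE) (rule that)
  note lim = lim'[rule_format]
  interpret M: prob_space M by fact
  have Tm: "T \<in> measurable M borel"
    using borel_measurable_continuous_onI[OF T] M(2) by (simp cong: measurable_cong_sets)
  have inv_int: "(\<integral>y. g (T y) \<partial>M) = (\<integral>y. g y \<partial>M)" if g: "continuous_on UNIV g" for g :: "'a \<Rightarrow> real"
  proof -
    obtain B where B: "B > 0" "\<And>y. norm (g y) \<le> B" using compact_continuous_bounded[OF cpt g] by blast
    have gT: "continuous_on UNIV (\<lambda>y. g (T y))" using continuous_on_compose2[OF g T] by simp
    have "(\<lambda>k. (\<integral>y. g (T y) \<partial>measure_pmf (p (r k))) - (\<integral>y. g y \<partial>measure_pmf (p (r k)))) \<longlonglongrightarrow> 0"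
    proof (rule Lim_null_comparison)
      have "(\<lambda>k. 2 * B * (1 / real (Suc k))) \<longlonglongrightarrow> 2 * B * 0"
        by (intro tendsto_mult_left LIMSEQ_Suc lim_1_over_n)
      thus "(\<lambda>k. 2 * B * (1 / real (Suc k))) \<longlonglongrightarrow> 0" by simp
      \<comment> \<open>The sum telescopes, and \<open>n m \<ge> Suc m \<ge> Suc k\<close>. This is
        applied with \<open>m = r k\<close>, which is at least \<open>k\<close> because
        \<open>r\<close> is strictly increasing.\<close>
      have "norm ((\<integral>y. g (T y) \<partial>measure_pmf (p m)) - (\<integral>y. g y \<partial>measure_pmf (p m))) \<le> 2 * B * (1 / real (Suc k))"
        if "m \<ge> k" for m k
      proof -
        have "(\<integral>y. g (T y) \<partial>measure_pmf (p m)) - (\<integral>y. g y \<partial>measure_pmf (p m)) =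
              (\<Sum>i<n m. g ((T ^^ Suc i) (x m)) - g ((T ^^ i) (x m))) / real (n m)"
          by (simp add: avg sum_subtractf diff_divide_distrib)
        also have "(\<Sum>i<n m. g ((T ^^ Suc i) (x m)) - g ((T ^^ i) (x m))) = g ((T ^^ n m) (x m)) - g (x m)"
          by (subst sum_lessThan_telescope) simp
        also have "norm ((g ((T ^^ n m) (x m)) - g (x m)) / real (n m)) \<le> 2 * B / real (Suc k)"
        proof -
          have "norm (g ((T ^^ n m) (x m)) - g (x m)) \<le> 2 * B"
            using norm_triangle_ineq4[of "g ((T ^^ n m) (x m))" "g (x m)"] B(2)[of "(T ^^ n m) (x m)"] B(2)[of "x m"]
            by linarith
          thus ?thesis unfolding norm_divide using n[of m] that by (intro frac_le) auto
        qed
        finally show ?thesis by simp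
      qed
      thus "\<forall>\<^sub>F k in sequentially. norm ((\<integral>y. g (T y) \<partial>measure_pmf (p (r k))) - (\<integral>y. g y \<partial>measure_pmf (p (r k))))
         \<le> 2 * B * (1 / real (Suc k))"
        using seq_suble[OF r] by simp
    qed
    from LIMSEQ_unique[OF this tendsto_diff[OF lim[OF gT] lim[OF g]]] show ?thesis by simp
  qed
  have "distr M borel T = M"
  proof (rule measure_eqI_continuous_integrals[OF M.prob_space_distr[OF Tm] _ M])
    fix g :: "'a \<Rightarrow> real" assume g: "continuous_on UNIV g"
    show "(\<integral>y. g y \<partial>distr M borel T) = (\<integral>y. g y \<partial>M)"
      using inv_int[OF g] by (simp add: integral_distr[OF Tm borel_measurable_continuous_onI[OF g]])
  qed simp
  hence "emeasure M (T -` A) = emeasure M A" if "A \<in> sets borel" for A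
    using emeasure_distr[OF Tm, of A] that sets_eq_imp_space_eq[OF M(2)] by simp
  hence "invariant_borel_prob T M" using M by (simp add: invariant_borel_prob_def)
  hence "M = \<mu>" using ue \<mu> unfolding uniquely_ergodic_def by blast
  hence "\<forall>\<^sub>F k in sequentially. dist (\<integral>y. h y \<partial>measure_pmf (p (r k))) (\<integral>y. h y \<partial>\<mu>) < \<epsilon>"
    using tendstoD[OF lim[OF h] \<open>\<epsilon> > 0\<close>] by simp
  then obtain k where "dist (\<integral>y. h y \<partial>measure_pmf (p (r k))) (\<integral>y. h y \<partial>\<mu>) < \<epsilon>"
    using eventually_happens'[OF sequentially_bot] by blast
  with far[of "r k"] show False by (simp add: avg dist_real_def)
qed

lemma uniquely_ergodic_uniform_convergence:
  fixes T :: "'a::metric_space \<Rightarrow> 'a" and f :: "'a \<Rightarrow> complex"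
  assumes cpt: "compact (UNIV :: 'a set)" and T: "continuous_on UNIV T"
    and ue: "uniquely_ergodic T" and \<mu>: "invariant_borel_prob T \<mu>"
    and f: "continuous_on UNIV f" and \<epsilon>: "\<epsilon> > 0"
  shows "\<forall>\<^sub>F n in sequentially. \<forall>x. norm ((\<Sum>i<n. f ((T ^^ i) x)) / of_nat n - (\<integral>y. f y \<partial>\<mu>)) < \<epsilon>"
proof -
  have \<mu>': "prob_space \<mu>" "sets \<mu> = sets borel" using \<mu> by (auto simp: invariant_borel_prob_def)
  interpret \<mu>: prob_space \<mu> by fact
  obtain B where B: "B > 0" "\<And>x. norm (f x) \<le> B" using compact_continuous_bounded[OF cpt f] by blast
  have int: "integrable \<mu> f"
    using B borel_measurable_continuous_onI[OF f] \<mu>'(2)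
    by (intro \<mu>.integrable_const_bound[of _ B]) (auto cong: measurable_cong_sets)
  note real = uniquely_ergodic_uniform_convergence_real[OF cpt T ue \<mu> _ half_gt_zero[OF \<epsilon>]]
  have "\<forall>\<^sub>F n in sequentially. \<forall>x. \<bar>(\<Sum>i<n. Re (f ((T ^^ i) x))) / real n - (\<integral>y. Re (f y) \<partial>\<mu>)\<bar> < \<epsilon> / 2"
    "\<forall>\<^sub>F n in sequentially. \<forall>x. \<bar>(\<Sum>i<n. Im (f ((T ^^ i) x))) / real n - (\<integral>y. Im (f y) \<partial>\<mu>)\<bar> < \<epsilon> / 2"
    by (intro real continuous_intros f)+
  thus ?thesis
  proof eventually_elim
    case (elim n)
    show ?case
    proof
      fix x
      let ?z = "(\<Sum>i<n. f ((T ^^ i) x)) / of_nat n - (\<integral>y. f y \<partial>\<mu>)"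
      have "norm ?z \<le> \<bar>Re ?z\<bar> + \<bar>Im ?z\<bar>" by (rule cmod_le)
      also have "\<dots> < \<epsilon> / 2 + \<epsilon> / 2"
        using elim[rule_format, of x] int by (intro add_strict_mono) simp_all
      finally show "norm ?z < \<epsilon>" by simp
    qed
  qed
qed

section \<open>Averages along squares\<close>

text \<open>Each shift by one replaces the first summand by the one just beyond the end, at a cost
  of at most \<open>2 * B\<close>.\<close>

lemma norm_sum_shift_le:
  fixes h :: "nat \<Rightarrow> complex"
  assumes "\<And>i. norm (h i) \<le> B"
  shows "norm ((\<Sum>i<N. h i) - (\<Sum>i<N. h (i + w))) \<le> 2 * real w * B"
proof (induction w)
  case (Suc w)
  have "(\<Sum>i<N. h (i + Suc w)) - (\<Sum>i<N. h (i + w)) = h (N + w) - h w"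
    using sum_lessThan_telescope[of "\<lambda>i. h (i + w)" N] by (simp add: sum_subtractf)
  hence "(\<Sum>i<N. h i) - (\<Sum>i<N. h (i + Suc w)) = ((\<Sum>i<N. h i) - (\<Sum>i<N. h (i + w))) - (h (N + w) - h w)"
    by (simp add: algebra_simps)
  also have "norm \<dots> \<le> 2 * real w * B + (B + B)"
    by (intro order_trans[OF norm_triangle_ineq4] add_mono Suc assms)
  finally show ?case by (simp add: algebra_simps)
qed simp

text \<open>The comparison passes from the exponent \<open>m\<close> to \<open>m + s * p\<close> by
  rigidity along \<open>p\<close>, to its residue modulo \<open>q\<close> by rigidity along
  \<open>q\<close>, to the average over \<open>a < q\<close> by \<open>equi\<close>, and to
  \<open>I\<close> by \<open>birkhoff\<close>. The bound \<open>size\<close> keeps the quotient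
  discarded in the reduction below \<open>R\<close>.\<close>

lemma rigid_quadratic_block:
  fixes T :: "'a \<Rightarrow> 'a" and f :: "'a \<Rightarrow> complex"
  defines "X \<equiv> \<lambda>J::nat. {..<J} \<times> {..<J} \<times> {..<J}"
  assumes J: "J > 0" and q: "q > 0"
    and rigid_p: "\<And>s z. s < J \<Longrightarrow> norm (f ((T ^^ (s * p)) z) - f z) \<le> e\<^sub>1"
    and rigid_q: "\<And>t z. real t < R \<Longrightarrow> norm (f ((T ^^ (t * q)) z) - f z) \<le> e\<^sub>1"
    and size: "real (4 * c * J + 4 * J\<^sup>2 + J * p) < R * real q"
    and equi: "norm ((\<Sum>(u, v, s)\<in>X J. f ((T ^^ ((2 * c * (u + v) + (u + v)\<^sup>2 + s * p) mod q)) y))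
                 / of_nat J ^ 3 - (\<Sum>a<q. f ((T ^^ a) y)) / of_nat q) \<le> e\<^sub>2"
    and birkhoff: "norm ((\<Sum>a<q. f ((T ^^ a) y)) / of_nat q - I) \<le> e\<^sub>3"
  shows "norm ((\<Sum>(u, v, s)\<in>X J. f ((T ^^ (2 * c * (u + v) + (u + v)\<^sup>2)) y)) / of_nat J ^ 3 - I)
           \<le> 2 * e\<^sub>1 + e\<^sub>2 + e\<^sub>3"
proof -
  define m where "m u v = 2 * c * (u + v) + (u + v)\<^sup>2" for u v
  have step: "norm (f ((T ^^ m u v) y) - f ((T ^^ ((m u v + s * p) mod q)) y)) \<le> 2 * e\<^sub>1"
    if "u < J" "v < J" "s < J" for u v s
  proof -
    define n where "n = m u v + s * p"
    have "u + v \<le> 2 * J" using that by simp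
    hence "2 * c * (u + v) \<le> 2 * c * (2 * J)" "(u + v)\<^sup>2 \<le> (2 * J)\<^sup>2" "s * p \<le> J * p"
      using that by (intro mult_left_mono power_mono mult_right_mono; simp)+
    hence "n \<le> 2 * c * (2 * J) + (2 * J)\<^sup>2 + J * p"
      unfolding n_def m_def by (intro add_mono)
    also have "\<dots> = 4 * c * J + 4 * J\<^sup>2 + J * p" by (simp add: power_mult_distrib)
    finally have "n \<le> 4 * c * J + 4 * J\<^sup>2 + J * p" .
    hence "real n < R * real q" using size by linarith
    moreover have "real (n div q) * real q \<le> real n"
      by (metis div_times_less_eq_dividend of_nat_le_iff of_nat_mult)
    ultimately have "real (n div q) * real q < R * real q" by linarith
    hence t: "real (n div q) < R" using q by simp
    \<comment> \<open>The point reached after \<open>n\<close> steps is compared with two earlier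
      ones, \<open>s * p\<close> steps and \<open>n div q * q\<close> steps back.\<close>
    have "(T ^^ n) y = (T ^^ (s * p)) ((T ^^ m u v) y)"
      by (simp add: n_def add.commute[of "m u v"] funpow_add)
    moreover have "(T ^^ n) y = (T ^^ (n div q * q)) ((T ^^ (n mod q)) y)"
      by (metis comp_apply div_mult_mod_eq funpow_add)
    ultimately have "norm (f ((T ^^ n) y) - f ((T ^^ (n mod q)) y)) \<le> e\<^sub>1"
      "norm (f ((T ^^ n) y) - f ((T ^^ m u v) y)) \<le> e\<^sub>1"
      using rigid_p[OF that(3)] rigid_q[OF t] by metis+
    hence "norm ((f ((T ^^ n) y) - f ((T ^^ (n mod q)) y)) - (f ((T ^^ n) y) - f ((T ^^ m u v) y))) \<le> e\<^sub>1 + e\<^sub>1"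
      by (rule order_trans[OF norm_triangle_ineq4 add_mono])
    thus ?thesis by (simp add: n_def)
  qed
  define U where "U = (\<Sum>(u, v, s)\<in>X J. f ((T ^^ m u v) y))"
  define V where "V = (\<Sum>(u, v, s)\<in>X J. f ((T ^^ ((m u v + s * p) mod q)) y))"
  define W where "W = (\<Sum>a<q. f ((T ^^ a) y)) / of_nat q"
  have "norm (U - V) \<le> of_nat (card (X J)) * (2 * e\<^sub>1)"
    unfolding U_def V_def sum_subtractf[symmetric]
    by (rule order_trans[OF norm_sum sum_bounded_above]) (auto simp: X_def intro!: step)
  also have "card (X J) = J ^ 3" by (simp add: X_def power3_eq_cube)
  finally have "norm (U / of_nat J ^ 3 - V / of_nat J ^ 3) \<le> 2 * e\<^sub>1"
    using J by (simp add: norm_divide norm_power field_simps flip: diff_divide_distrib)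
  moreover have "norm (V / of_nat J ^ 3 - W) \<le> e\<^sub>2" using equi by (simp add: V_def W_def m_def)
  moreover have "norm (W - I) \<le> e\<^sub>3" using birkhoff by (simp add: W_def)
  ultimately have "norm ((U / of_nat J ^ 3 - V / of_nat J ^ 3) + (V / of_nat J ^ 3 - W) + (W - I)) \<le> 2 * e\<^sub>1 + e\<^sub>2 + e\<^sub>3"
    by (intro order_trans[OF norm_triangle_ineq] add_mono)
  thus ?thesis by (simp add: U_def m_def)
qed

text \<open>Since \<open>(i + w)^2 = i^2 + 2 * i * w + w^2\<close>, shifting the index by
  \<open>w = u + v\<close> turns the summand at \<open>i\<close> into a block term with
  \<open>c = i\<close> at the point \<open>(T ^^ (i\<^sup>2)) x\<close>. As
  \<open>u + v \<le> 2 * J\<close>, each shift changes the sum by at most \<open>4 * J * B\<close>.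
  The index \<open>s\<close> contributes a factor \<open>J\<close> and lets the block estimate apply
  verbatim.\<close>

lemma square_average_via_blocks:
  fixes T :: "'a \<Rightarrow> 'a" and f :: "'a \<Rightarrow> complex"
  defines "X \<equiv> \<lambda>J::nat. {..<J} \<times> {..<J} \<times> {..<J}"
  assumes J: "J > 0" and N: "N > 0" and B: "\<And>z. norm (f z) \<le> B"
    and block: "\<And>c y. c < N \<Longrightarrow>
      norm ((\<Sum>(u, v, s)\<in>X J. f ((T ^^ (2 * c * (u + v) + (u + v)\<^sup>2)) y)) / of_nat J ^ 3 - I) \<le> e"
  shows "norm ((\<Sum>i<N. f ((T ^^ (i\<^sup>2)) x)) / of_nat N - I) \<le> 4 * real J * B / real N + e"
proof -
  define h where "h i = f ((T ^^ (i\<^sup>2)) x)" for i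
  define A where "A = (\<Sum>i<N. h i)"
  define S where "S = (\<Sum>(u, v, s)\<in>X J. \<Sum>i<N. h (i + (u + v)))"
  have B0: "B \<ge> 0" using B norm_ge_zero order_trans by blast
  have card: "card (X J) = J ^ 3" by (simp add: X_def power3_eq_cube)
  have "norm (of_nat (card (X J)) * A - S) = norm (\<Sum>(u, v, s)\<in>X J. A - (\<Sum>i<N. h (i + (u + v))))"
    by (simp add: S_def sum_subtractf case_prod_unfold)
  also have "\<dots> \<le> of_nat (card (X J)) * (4 * real J * B)"
  proof (rule order_trans[OF norm_sum sum_bounded_above], clarify)
    fix u v s assume "(u, v, s) \<in> X J"
    hence "real (u + v) \<le> 2 * real J" by (simp add: X_def)
    hence "2 * real (u + v) * B \<le> 2 * (2 * real J) * B" using B0 by (intro mult_left_mono mult_right_mono) auto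
    moreover have "norm (A - (\<Sum>i<N. h (i + (u + v)))) \<le> 2 * real (u + v) * B"
      unfolding A_def by (rule norm_sum_shift_le) (simp add: h_def B)
    ultimately show "norm (A - (\<Sum>i<N. h (i + (u + v)))) \<le> 4 * real J * B" by simp
  qed
  finally have 1: "norm (of_nat J ^ 3 * A - S) \<le> real J ^ 3 * (4 * real J * B)" by (simp add: card)
  have hi: "h (i + (u + v)) = f ((T ^^ (2 * i * (u + v) + (u + v)\<^sup>2)) ((T ^^ (i\<^sup>2)) x))" for i u v
  proof -
    have "(i + (u + v))\<^sup>2 = (2 * i * (u + v) + (u + v)\<^sup>2) + i\<^sup>2" by (simp add: power2_sum)
    thus ?thesis unfolding h_def by (simp only: funpow_add comp_apply)
  qed
  define b where "b i = (\<Sum>(u, v, s)\<in>X J. h (i + (u + v)))" for i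
  have bnd: "norm (b i - of_nat J ^ 3 * I) \<le> real J ^ 3 * e" if "i < N" for i
  proof -
    have "norm (b i / of_nat J ^ 3 - I) \<le> e" unfolding b_def hi by (rule block[OF that])
    moreover have "b i / of_nat J ^ 3 - I = (b i - of_nat J ^ 3 * I) / of_nat J ^ 3"
      using J by (simp add: field_simps)
    ultimately show ?thesis using J by (simp add: norm_divide norm_power field_simps)
  qed
  have "S = (\<Sum>i<N. b i)" unfolding S_def b_def case_prod_unfold by (rule sum.swap)
  hence "norm (S - of_nat N * (of_nat J ^ 3 * I)) = norm (\<Sum>i<N. b i - of_nat J ^ 3 * I)"
    by (simp add: sum_subtractf)
  also have "\<dots> \<le> of_nat (card {..<N}) * (real J ^ 3 * e)"
    by (rule order_trans[OF norm_sum sum_bounded_above]) (auto intro: bnd)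
  finally have 2: "norm (S - of_nat N * (of_nat J ^ 3 * I)) \<le> real N * (real J ^ 3 * e)" by simp
  have "norm ((of_nat J ^ 3 * A - S) + (S - of_nat N * (of_nat J ^ 3 * I))) \<le>
     real J ^ 3 * (4 * real J * B) + real N * (real J ^ 3 * e)"
    by (intro order_trans[OF norm_triangle_ineq] add_mono 1 2)
  moreover have "A / of_nat N - I = ((of_nat J ^ 3 * A - S) + (S - of_nat N * (of_nat J ^ 3 * I))) / (of_nat J ^ 3 * of_nat N)"
    using J N by (simp add: field_simps)
  ultimately have "norm (A / of_nat N - I) \<le> (real J ^ 3 * (4 * real J * B) + real N * (real J ^ 3 * e)) / (real J ^ 3 * real N)"
    by (simp add: norm_divide norm_mult norm_power divide_right_mono)
  also have "\<dots> = 4 * real J * B / real N + e" using J N by (simp add: add_divide_distrib)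
  finally show ?thesis by (simp add: A_def h_def)
qed

theorem theorem1:
  fixes T :: "'a::metric_space \<Rightarrow> 'a" and \<mu> :: "'a measure"
    and q :: "nat \<Rightarrow> nat" and f :: "'a \<Rightarrow> complex"
  assumes "topological_dynamical_system T"
    and "uniquely_ergodic T"
    and "invariant_borel_prob T \<mu>"
    and "strict_mono q"
    and "\<And>n. q n > 0"
    and "\<And>n. gcd (q n) (q (Suc n)) = 1"
    and "(\<lambda>n. Max ((\<lambda>t. SUP x. dist x ((T ^^ (t * q n)) x)) `
                    {t::nat. real t < real (q (Suc n)) powr (4/5)})) \<longlonglongrightarrow> 0"
    and "continuous_on UNIV f"
  shows "uniform_limit UNIV
           (\<lambda>N x. (\<Sum>i<N. f ((T ^^ (i\<^sup>2)) x)) / of_nat N)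
           (\<lambda>x. \<integral>y. f y \<partial>\<mu>) sequentially"
proof (rule uniform_limitI)
  fix \<epsilon> :: real assume \<epsilon>: "\<epsilon> > 0"
  define I where "I = (\<integral>y. f y \<partial>\<mu>)"
  have cpt: "compact (UNIV :: 'a set)" and T: "continuous_on UNIV T"
    using assms(1) unfolding topological_dynamical_system_def homeomorphism_def by auto
  obtain B where B: "B > 0" "\<And>z. norm (f z) \<le> B"
    using compact_continuous_bounded[OF cpt assms(8)] by blast
  \<comment> \<open>The final error is at most \<open>5 * e\<close>: four from the blocks and one
    from the shifts.\<close>
  define e where "e = \<epsilon> / 8"
  have e: "e > 0" using \<epsilon> by (simp add: e_def)
  obtain \<rho> where \<rho>: "\<rho> > 0" "\<And>x y. dist x y < \<rho> \<Longrightarrow> norm (f y - f x) \<le> e"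
    using compact_uniformly_continuous[OF assms(8) cpt] e unfolding uniformly_continuous_on_def
    by (metis UNIV_I dist_commute dist_norm less_imp_le)
  define \<delta> where "\<delta> n = Max ((\<lambda>t. SUP x. dist x ((T ^^ (t * q n)) x)) `
                    {t::nat. real t < real (q (Suc n)) powr (4/5)})" for n
  \<comment> \<open>\<open>Max\<close> and \<open>SUP\<close> bound their entries only for a finite
    set and a bounded family; compactness provides the latter.\<close>
  have dist_le: "dist x ((T ^^ (t * q n)) x) \<le> \<delta> n" if t: "real t < real (q (Suc n)) powr (4/5)" for t n x
  proof -
    have "finite {t::nat. real t < real (q (Suc n)) powr (4/5)}"
      by (rule finite_subset[of _ "{..nat \<lceil>real (q (Suc n)) powr (4/5)\<rceil>}"]) (auto, linarith)
    hence "(SUP x. dist x ((T ^^ (t * q n)) x)) \<le> \<delta> n"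
      unfolding \<delta>_def using t by (intro Max_ge) auto
    moreover have "bdd_above (range (\<lambda>x. dist x ((T ^^ (t * q n)) x)))"
    proof -
      obtain D where "\<forall>x::'a\<in>UNIV. \<forall>y\<in>UNIV. dist x y \<le> D"
        using compact_imp_bounded[OF cpt] unfolding bounded_two_points by blast
      thus ?thesis by (intro bdd_aboveI[of _ D]) auto
    qed
    ultimately show ?thesis using cSUP_upper[of x UNIV "\<lambda>x. dist x ((T ^^ (t * q n)) x)"] by simp
  qed
  have rigid: "norm (f ((T ^^ (t * q n)) z) - f z) \<le> e"
    if "\<delta> n < \<rho>" "real t < real (q (Suc n)) powr (4/5)" for t n z
    using \<rho>(2)[of z "(T ^^ (t * q n)) z"] dist_le[OF that(2), of z] that(1) by simp

  define equi where "equi k \<longleftrightarrow> (\<forall>p c (F :: nat \<Rightarrow> complex). coprime p k \<longrightarrow> (\<forall>a<k. norm (F a) \<le> B) \<longrightarrow>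
      norm ((\<Sum>(u, v, s)\<in>{..<block_length k} \<times> {..<block_length k} \<times> {..<block_length k}.
               F ((2 * c * (u + v) + (u + v)\<^sup>2 + s * p) mod k)) / of_nat (block_length k) ^ 3
            - (\<Sum>a<k. F a) / of_nat k) \<le> e)" for k
  \<comment> \<open>The three growth conditions with factors 12, 12 and 3 place the terms
    \<open>4 * c * J\<close>, \<open>4 * J^2\<close> and \<open>J * q n\<close> of the exponent
    below \<open>R * k / 3\<close> each; the last condition makes the cost of the shifts at most
    \<open>e\<close>.\<close>
  define good where "good k \<longleftrightarrow> k > 0 \<and> block_length k > 0 \<and> equi k \<and>
     (\<forall>x. norm ((\<Sum>i<k. f ((T ^^ i) x)) / of_nat k - I) < e) \<and>
     12 * real k powr (3/4) < real k \<and> 12 * real k powr (3/2) < real k powr (9/5) \<and>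
     3 * real k powr (7/4) < real k powr (9/5) \<and> 4 * B * real k powr (3/4) < e * real k powr (4/5)" for k
  have good: "\<forall>\<^sub>F k in sequentially. good k"
  proof -
    have "\<forall>\<^sub>F x :: real in at_top. x powr (3/4) > 2 \<and> 12 * x powr (3/4) < x \<and> 12 * x powr (3/2) < x powr (9/5) \<and>
       3 * x powr (7/4) < x powr (9/5)"
      by (intro eventually_conj; real_asymp)
    moreover have "\<forall>\<^sub>F x :: real in at_top. 4 * B * x powr (3/4) < e * x powr (4/5)"
      using e B(1) by real_asymp
    ultimately have "\<forall>\<^sub>F x :: real in at_top. (x powr (3/4) > 2 \<and> 12 * x powr (3/4) < x \<and> 12 * x powr (3/2) < x powr (9/5) \<and>
       3 * x powr (7/4) < x powr (9/5)) \<and> 4 * B * x powr (3/4) < e * x powr (4/5)"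
      by (rule eventually_conj)
    hence "\<forall>\<^sub>F k in sequentially. (real k powr (3/4) > 2 \<and> 12 * real k powr (3/4) < real k \<and>
       12 * real k powr (3/2) < real k powr (9/5) \<and>
       3 * real k powr (7/4) < real k powr (9/5)) \<and> 4 * B * real k powr (3/4) < e * real k powr (4/5)"
      by (rule eventually_compose_filterlim) (rule filterlim_real_sequentially)
    moreover have "\<forall>\<^sub>F k in sequentially. equi k"
      unfolding equi_def by (rule quadratic_equidistribution[OF B(1) e])
    moreover have "\<forall>\<^sub>F k in sequentially. \<forall>x. norm ((\<Sum>i<k. f ((T ^^ i) x)) / of_nat k - I) < e"
      unfolding I_def by (rule uniquely_ergodic_uniform_convergence[OF cpt T assms(2,3,8) e])
    ultimately show ?thesis
    proof eventually_elim
      case (elim k)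
      have "block_length k > 0" using elim(1) block_length_ge[of k] by linarith
      moreover have "k > 0" using elim(1) by (cases "k = 0") auto
      ultimately show ?case using elim unfolding good_def by blast
    qed
  qed
  have q_lim: "filterlim (\<lambda>n. q (Suc n)) sequentially sequentially"
    using filterlim_subseq[OF assms(4)] by (rule filterlim_compose) (rule filterlim_Suc)
  have "\<forall>\<^sub>F n in sequentially. \<delta> n < \<rho>"
    using assms(7) \<rho>(1) unfolding \<delta>_def by (rule order_tendstoD)
  moreover from this have "\<forall>\<^sub>F n in sequentially. \<delta> (Suc n) < \<rho>"
    by (rule eventually_compose_filterlim) (rule filterlim_Suc)
  moreover have "\<forall>\<^sub>F n in sequentially. good (q (Suc n))"
    using good q_lim by (rule eventually_compose_filterlim)
  ultimately have "\<forall>\<^sub>F n in sequentially. \<delta> n < \<rho> \<and> \<delta> (Suc n) < \<rho> \<and> good (q (Suc n))"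
    by eventually_elim auto
  then obtain n\<^sub>0 where n\<^sub>0: "\<And>n. n \<ge> n\<^sub>0 \<Longrightarrow> \<delta> n < \<rho> \<and> \<delta> (Suc n) < \<rho> \<and> good (q (Suc n))"
    unfolding eventually_sequentially by blast

  have main: "norm ((\<Sum>i<N. f ((T ^^ (i\<^sup>2)) x)) / of_nat N - I) < \<epsilon>"
    if n: "n \<ge> n\<^sub>0" and N: "real (q (Suc n)) powr (4/5) \<le> real N" "real N < real (q (Suc (Suc n))) powr (4/5)"
    for n N x
  proof -
    define k where "k = q (Suc n)"
    define J where "J = block_length k"
    define R where "R = real (q (Suc (Suc n))) powr (4/5)"
    have \<delta>: "\<delta> n < \<rho>" "\<delta> (Suc n) < \<rho>" and g: "good k" using n\<^sub>0[OF n] by (auto simp: k_def)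
    note g = g[unfolded good_def]
    have k: "k > 0" "J > 0" using g by (auto simp: J_def)
    have J: "real J \<le> real k powr (3/4)" unfolding J_def by (rule block_length_le)
    have Npos: "N > 0" using N(1) k(1) by (cases "N = 0") (auto simp: k_def)
    have pk: "q n \<le> k" using assms(4) by (simp add: k_def strict_mono_less_eq)
    have kR: "real k powr (4/5) < R" using N unfolding k_def R_def by linarith
    have size: "real (4 * c * J + 4 * J\<^sup>2 + J * q n) < R * real k" if "c < N" for c
    proof -
      \<comment> \<open>The upper end of the range of \<open>N\<close> enters here: the exponents
        grow with \<open>c\<close>, and \<open>c < N < R\<close> keeps them below
        \<open>R * k\<close>.\<close>
      have cR: "real c \<le> R" using that N(2) by (simp add: R_def)
      have R0: "R > 0" using assms(5)[of "Suc (Suc n)"] by (simp add: R_def)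
      have "4 * real c * real J \<le> 4 * R * real k powr (3/4)"
        using cR J by (intro mult_mono) auto
      also have "\<dots> < R * real k / 3" using g R0 by (simp add: field_simps)
      finally have 1: "4 * real c * real J < R * real k / 3" .
      have kk: "real k powr (9/5) = real k powr (4/5) * real k"
        using k(1) powr_add[of "real k" "4/5" 1] by simp
      have "real k powr (4/5) * real k \<le> R * real k" using kR by (intro mult_right_mono) auto
      hence kk': "real k powr (9/5) \<le> R * real k" unfolding kk .
      have "4 * real J ^ 2 \<le> 4 * (real k powr (3/4)) ^ 2" using J by (intro mult_left_mono power_mono) auto
      also have "(real k powr (3/4)) ^ 2 = real k powr (3/2)"
        by (simp add: power2_eq_square flip: powr_add)
      finally have 2: "4 * real J ^ 2 < R * real k / 3" using g kk' by linarith
      have "real J * real (q n) \<le> real k powr (3/4) * real k" using J pk by (intro mult_mono) auto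
      also have "\<dots> = real k powr (7/4)" using k(1) powr_add[of "real k" "3/4" 1] by simp
      finally have 3: "real J * real (q n) < R * real k / 3" using g kk' by linarith
      show ?thesis using 1 2 3 by simp
    qed
    have "norm ((\<Sum>i<N. f ((T ^^ (i\<^sup>2)) x)) / of_nat N - I) \<le> 4 * real J * B / real N + (2 * e + e + e)"
    proof (rule square_average_via_blocks[OF k(2) Npos B(2)])
      fix c y assume c: "c < N"
      show "norm ((\<Sum>(u, v, s)\<in>{..<J} \<times> {..<J} \<times> {..<J}. f ((T ^^ (2 * c * (u + v) + (u + v)\<^sup>2)) y))
              / of_nat J ^ 3 - I) \<le> 2 * e + e + e"
      proof (rule rigid_quadratic_block[OF k(2,1) _ _ size[OF c]])
        fix s z assume "s < J"
        \<comment> \<open>The block length stays within the range of rigidity along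
          \<open>q n\<close>, which reaches up to \<open>k powr (4/5)\<close>.\<close>
        have "real k powr (3/4) \<le> real k powr (4/5)" using k(1) by (intro powr_mono) auto
        hence "real s < real (q (Suc n)) powr (4/5)" using \<open>s < J\<close> J by (simp add: k_def)
        thus "norm (f ((T ^^ (s * q n)) z) - f z) \<le> e" by (rule rigid[OF \<delta>(1)])
      next
        fix t z assume "real t < R"
        thus "norm (f ((T ^^ (t * k)) z) - f z) \<le> e"
          using rigid[OF \<delta>(2)] by (simp add: k_def R_def)
      next
        have cop: "coprime (q n) k" using assms(6)[of n] by (simp add: k_def coprime_iff_gcd_eq_1)
        have "equi k" using g by simp
        from this[unfolded equi_def, rule_format, OF cop, where F="\<lambda>a. f ((T ^^ a) y)" and c=c]
        show "norm ((\<Sum>(u, v, s)\<in>{..<J} \<times> {..<J} \<times> {..<J}. f ((T ^^ ((2 * c * (u + v) + (u + v)\<^sup>2 + s * q n) mod k)) y))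
                 / of_nat J ^ 3 - (\<Sum>a<k. f ((T ^^ a) y)) / of_nat k) \<le> e"
          using B(2) by (simp add: J_def)
      next
        show "norm ((\<Sum>a<k. f ((T ^^ a) y)) / of_nat k - I) \<le> e" using g by (auto intro: less_imp_le)
      qed
    qed
    moreover have "4 * real J * B / real N \<le> e"
    proof -
      have "4 * real J * B \<le> 4 * B * real k powr (3/4)" using J B(1) by simp
      also have "\<dots> \<le> e * real k powr (4/5)" using g by simp
      also have "\<dots> \<le> e * real N" using N(1) e by (simp add: k_def)
      finally show ?thesis using Npos by (simp add: field_simps)
    qed
    ultimately show ?thesis using \<epsilon> by (simp add: e_def)
  qed

  have "\<forall>\<^sub>F N in sequentially. real N \<ge> real (q (Suc n\<^sub>0)) powr (4/5)"
    using filterlim_real_sequentially by (simp add: filterlim_at_top)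
  thus "\<forall>\<^sub>F N in sequentially. \<forall>x\<in>UNIV. dist ((\<Sum>i<N. f ((T ^^ (i\<^sup>2)) x)) / of_nat N) (\<integral>y. f y \<partial>\<mu>) < \<epsilon>"
  proof eventually_elim
    case (elim N)
    \<comment> \<open>Minimality places \<open>N\<close> between the \<open>4/5\<close>-th powers of
      \<open>q m\<close> and \<open>q (Suc m)\<close>, so \<open>main\<close> applies with the
      predecessor \<open>n\<close> of \<open>m\<close>; the lower bound on \<open>N\<close> ensures
      \<open>n \<ge> n\<^sub>0\<close>.\<close>
    define m where "m = (LEAST m. real N < real (q (Suc m)) powr (4/5))"
    have "filterlim (\<lambda>m. real (q (Suc m)) powr (4/5)) at_top sequentially"
    proof -
      have "filterlim (\<lambda>x :: real. x powr (4/5)) at_top at_top" by real_asymp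
      moreover have "filterlim (\<lambda>m. real (q (Suc m))) at_top sequentially"
        using filterlim_real_sequentially q_lim by (rule filterlim_compose)
      ultimately show ?thesis by (rule filterlim_compose)
    qed
    hence "\<forall>\<^sub>F m in sequentially. real (q (Suc m)) powr (4/5) > real N"
      by (simp add: filterlim_at_top_dense)
    then obtain m' where "real N < real (q (Suc m')) powr (4/5)"
      using eventually_happens'[OF sequentially_bot] by blast
    hence m: "real N < real (q (Suc m)) powr (4/5)"
      unfolding m_def by (rule LeastI[of "\<lambda>m. real N < real (q (Suc m)) powr (4/5)"])
    have "\<not> m \<le> n\<^sub>0"
    proof
      assume "m \<le> n\<^sub>0"
      hence "real (q (Suc m)) powr (4/5) \<le> real (q (Suc n\<^sub>0)) powr (4/5)"
        using assms(4) by (intro powr_mono2) (auto simp: strict_mono_less_eq)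
      with m elim show False by linarith
    qed
    then obtain n where n: "m = Suc n" "n \<ge> n\<^sub>0" by (cases m) auto
    have "\<not> real N < real (q (Suc n)) powr (4/5)"
      using not_less_Least[of n "\<lambda>m. real N < real (q (Suc m)) powr (4/5)"] n(1) by (simp add: m_def)
    thus ?case using main[OF n(2), of N] m by (auto simp: n(1) I_def dist_norm not_less)
  qed
qed

end
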